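(* Let $q=2^n$ with $n\ge 5$, and let \[ f(X)=aX^2+bX+\frac{1}{X-r}+\frac{1}{X-r^q}, \] where $a\in\mathbb{F}_q^*$, $b\in\mathbb{F}_2$ and $r\in\mathbb{F}_{q^2}\setminus\mathbb{F}_q$. Then $f$ is not a permutation rational function of $\mathbb{P}^1(\mathbb{F}_q)$.
   Context: $\mathbb{P}^1(\mathbb{F}_q)=\mathbb{F}_q\cup\{\infty\}$ is the projective line over $\mathbb{F}_q$. A rational function $f=P/Q\in\mathbb{F}_q(X)$ ($P,Q$ coprime) defines a map $\mathbb{P}^1(\mathbb{F}_q)\to\mathbb{P}^1(\mathbb{F}_q)$ in the usual way (zeros of $Q$ map to $\infty$, and $f(\infty)$ is the limiting value). A permutation rational function of $\mathbb{P}^1(\mathbb{F}_q)$ is a rational function whose induced map on $\mathbb{P}^1(\mathbb{F}_q)$ is a bijection. *)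

theory Defs
  imports "HOL-Computational_Algebra.Computational_Algebra" "HOL-Library.Cardinality"
begin

definition is_subfield :: "'a :: field set \<Rightarrow> bool" where
  "is_subfield F \<longleftrightarrow> 0 \<in> F \<and> 1 \<in> F \<and>
     (\<forall>x\<in>F. \<forall>y\<in>F. x + y \<in> F \<and> x * y \<in> F) \<and>
     (\<forall>x\<in>F. - x \<in> F \<and> inverse x \<in> F)"

text \<open>
  The point at infinity of a projective line is \<^term>\<open>None\<close>.
\<close>

definition proj_line :: "'a set \<Rightarrow> 'a option set" where
  "proj_line F = insert None (Some ` F)"

text \<open>
  Rational functions over \<open>'a\<close> are the elements of \<open>'a poly fract\<close>.
\<close>

definition rat_const :: "'a :: field \<Rightarrow> 'a poly fract" where
  "rat_const c = to_fract [:c:]"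

definition rat_X :: "'a :: field poly fract" where
  "rat_X = to_fract [:0, 1:]"

text \<open>
  The map induced on the projective line by \<open>P / Q\<close>, for coprime \<open>P\<close> and \<open>Q\<close>. In the last
  case the limiting value at infinity is \<open>0\<close> if \<open>degree P < degree Q\<close>, and the quotient of
  the leading coefficients if the degrees agree.
\<close>

fun quot_map :: "'a :: field poly \<Rightarrow> 'a poly \<Rightarrow> 'a option \<Rightarrow> 'a option" where
  "quot_map P Q (Some x) = (if poly Q x = 0 then None else Some (poly P x / poly Q x))"
| "quot_map P Q None =
     (if degree P > degree Q then None else Some (coeff P (degree Q) / lead_coeff Q))"

text \<open>
  The choice of the coprime representation is immaterial: see \<open>rat_map_Fract\<close> below.
\<close>

definition rat_map :: "'a :: field poly fract \<Rightarrow> 'a option \<Rightarrow> 'a option" where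
  "rat_map f = (let (P, Q) = (SOME (P, Q). Q \<noteq> 0 \<and> coprime P Q \<and> f = Fract P Q)
                in quot_map P Q)"

text \<open>
  Here \<open>F\<close> is a subfield of \<open>'a\<close> and \<open>f\<close> is a rational function with coefficients in \<open>F\<close>,
  viewed as a rational function over \<open>'a\<close>.
\<close>

definition perm_rat_fun :: "'a :: field set \<Rightarrow> 'a poly fract \<Rightarrow> bool" where
  "perm_rat_fun F f \<longleftrightarrow> bij_betw (rat_map f) (proj_line F) (proj_line F)"

lemma coprime_Fract_exists:
  fixes f :: "'a :: field poly fract"
  shows "\<exists>P Q. Q \<noteq> 0 \<and> coprime P Q \<and> f = Fract P Q"
proof -
  define R where "R = (\<lambda>(P, Q). Q \<noteq> 0 \<and> f = Fract P Q)"
  have "\<exists>x. R x"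
    by (cases f) (auto simp: R_def)
  then obtain x where x: "R x" and min: "\<And>y. R y \<Longrightarrow> degree (snd x) \<le> degree (snd y)"
    using ex_has_least_nat[of R _ "\<lambda>x. degree (snd x)"] by blast
  obtain P Q where [simp]: "x = (P, Q)" by (cases x)
  from x have Q: "Q \<noteq> 0" "f = Fract P Q" by (auto simp: R_def)
  have "coprime P Q"
  proof (rule coprimeI)
    fix d assume "d dvd P" "d dvd Q"
    then obtain P' Q' where PQ: "P = d * P'" "Q = d * Q'" by (auto elim!: dvdE)
    with Q have nz: "d \<noteq> 0" "Q' \<noteq> 0" by auto
    with Q PQ have "R (P', Q')" by (auto simp: R_def eq_fract)
    from min[OF this] have "degree d = 0" using PQ nz by (simp add: degree_mult_eq)
    with nz show "is_unit d" by (simp add: is_unit_iff_degree)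
  qed
  with Q show ?thesis by blast
qed

text \<open>
  Over a plain \<open>field\<close>, polynomials do not form a \<open>ring_gcd\<close>, so Euclid's lemma is proved by hand.
\<close>

lemma poly_coprime_dvd_mult:
  fixes P Q R :: "'a :: field poly"
  assumes cop: "coprime P Q" and "Q \<noteq> 0" and dvd: "Q dvd P * R"
  shows "Q dvd R"
proof -
  define I where "I = {d. d \<noteq> 0 \<and> (\<exists>A B. d = A * P + B * Q)}"
  have "Q = 0 * P + 1 * Q" by simp
  with \<open>Q \<noteq> 0\<close> have "Q \<in> I" unfolding I_def by blast
  then obtain d where d: "d \<in> I" and min: "\<And>e. e \<in> I \<Longrightarrow> degree d \<le> degree e"
    using ex_has_least_nat[of "\<lambda>x. x \<in> I" Q degree] by blast
  from d obtain A B where AB: "d = A * P + B * Q" and "d \<noteq> 0" by (auto simp: I_def)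
  have *: "d dvd S" if S: "S = C * P + D * Q" for S C D
  proof (rule ccontr)
    assume "\<not> d dvd S"
    hence nz: "S mod d \<noteq> 0" by (simp add: mod_eq_0_iff_dvd)
    have "S mod d = S - S div d * d" by (simp add: minus_div_mult_eq_mod)
    also have "\<dots> = (C - S div d * A) * P + (D - S div d * B) * Q"
      unfolding S[symmetric] by (subst AB, subst S) (simp add: algebra_simps)
    finally have "S mod d \<in> I" using nz unfolding I_def by blast
    from min[OF this] degree_mod_less[OF \<open>d \<noteq> 0\<close>, of S] nz show False by simp
  qed
  have "d dvd P" "d dvd Q" using *[of P 1 0] *[of Q 0 1] by simp_all
  with cop have "is_unit d" by (rule coprime_common_divisor)
  moreover have "d * R = A * (P * R) + (B * R) * Q" by (simp add: AB algebra_simps)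
  with dvd have "Q dvd d * R" by simp
  ultimately show ?thesis by (simp add: dvd_mult_unit_iff')
qed

lemma quot_map_unique:
  fixes P Q P' Q' :: "'a :: field poly"
  assumes "Q \<noteq> 0" "Q' \<noteq> 0" "coprime P Q" "coprime P' Q'" "Fract P Q = Fract P' Q'"
  shows "quot_map P Q = quot_map P' Q'"
proof -
  have eq: "P * Q' = P' * Q" using assms by (simp add: eq_fract)
  have "Q dvd Q'"
    by (rule poly_coprime_dvd_mult[OF assms(3,1)]) (simp add: eq)
  moreover have "Q' dvd Q"
    by (rule poly_coprime_dvd_mult[OF assms(4,2)]) (simp flip: eq)
  ultimately have deg: "degree Q = degree Q'"
    using assms(1,2) by (simp add: dvd_imp_degree_le order_antisym)
  from \<open>Q dvd Q'\<close> obtain u where u: "Q' = Q * u" by (rule dvdE)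
  with assms(1,2) deg have "degree u = 0" "u \<noteq> 0" by (auto simp: degree_mult_eq)
  then obtain c where c: "u = [:c:]" "c \<noteq> 0" by (auto elim: degree_eq_zeroE)
  have Q': "Q' = smult c Q" using u c by simp
  with eq have "smult c P * Q = P' * Q" by simp
  with assms(1) have P': "P' = smult c P" by (simp only: mult_cancel_right) simp
  show ?thesis
  proof
    fix y show "quot_map P Q y = quot_map P' Q' y"
      using c by (cases y) (auto simp: P' Q')
  qed
qed

lemma rat_map_Fract:
  fixes P Q :: "'a :: field poly"
  assumes "Q \<noteq> 0" "coprime P Q"
  shows "rat_map (Fract P Q) = quot_map P Q"
proof -
  define p where "p = (SOME (P', Q'). Q' \<noteq> 0 \<and> coprime P' Q' \<and> Fract P Q = Fract P' Q')"
  have "case p of (P', Q') \<Rightarrow> Q' \<noteq> 0 \<and> coprime P' Q' \<and> Fract P Q = Fract P' Q'"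
    unfolding p_def by (rule someI[of _ "(P, Q)"]) (use assms in simp)
  moreover have "rat_map (Fract P Q) = quot_map (fst p) (snd p)"
    by (simp add: rat_map_def p_def Let_def case_prod_unfold)
  ultimately show ?thesis
    using quot_map_unique[of "snd p" Q "fst p" P] assms by (auto simp: case_prod_unfold)
qed

end

theory Submission
  imports Defs
begin

text \<open>
  Write \<open>t = r + r\<^sup>q\<close>, \<open>A = a t\<^sup>3\<close>, \<open>B = b t\<^sup>2\<close>, \<open>d = r\<^sup>q\<^sup>+\<^sup>1 / t\<^sup>2\<close>. Up to scaling, \<open>f\<close> is
  \<open>A x\<^sup>2 + B x + 1 / (x\<^sup>2 + x + d)\<close>. Solving for collisions \<open>x, x + s\<close> shows that injectivity forces
  \<open>Tr(h) Tr(h / s\<^sup>2 + h) = 0\<close> for all admissible \<open>s\<close>, where \<open>h = 1 / ((A s + B)(s + 1))\<close>; here \<open>d\<close>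
  has dropped out. A Moebius change of variable turns this into the vanishing on \<open>F - {0, 1}\<close> of
  \<open>Tr(\<alpha> x + \<beta> / x) Tr(\<delta> / x + \<nu> / (1 + x))\<close> (if \<open>B \<noteq> 0\<close>) or of \<open>Tr(c v + c / v) Tr(c v\<^sup>3 + c v)\<close>
  (if \<open>B = 0\<close>). Multiplying by \<open>x\<^sup>M\<close> and summing over \<open>x\<close> extracts a coefficient of this function;
  since \<open>\<Sum> x\<^sup>k / (1 + x)\<^bsup>2^j\<^esup>\<close> is the \<open>j\<close>-th binary digit of \<open>k\<close>, these coefficients are governed by
  carries in \<open>M + 2\<^sup>i\<close> and borrows in \<open>M - 2\<^sup>i\<close>, and a few well-chosen \<open>M\<close> give a contradiction.
\<close>

subsection \<open>Power sums over a subfield of characteristic 2\<close>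

text \<open>The subfield is a set inside a fixed field type, so that the same facts apply both to
  \<open>F\<close> and to its quadratic extension \<open>UNIV\<close>.\<close>

locale char2_subfield =
  fixes F :: "'a :: field set" and n :: nat
  assumes subfield: "is_subfield F" and card_F: "card F = 2 ^ n"
    and char2: "(1 :: 'a) + 1 = 0" and n_ge_2: "n \<ge> 2"
begin

lemma add_self [simp]: "x + x = (0 :: 'a)"
  by (metis char2 distrib_left mult.right_neutral mult_zero_right)

lemma add_self_left [simp]: "x + (x + y) = (y :: 'a)"
  by (simp flip: add.assoc)

lemma uminus_eq [simp]: "- x = (x :: 'a)"
  by (simp add: minus_unique)

lemma minus_eq [simp]: "x - y = x + (y :: 'a)"
  by (metis diff_conv_add_uminus uminus_eq)

lemma add_eq_0_iff_eq: "x + y = 0 \<longleftrightarrow> x = (y :: 'a)"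
  using add_eq_0_iff[of x y] by auto

lemma two_eq_0 [simp]: "(2 :: 'a) = 0"
  by (metis char2 one_add_one)

lemma of_nat_eq_of_bool: "(of_nat k :: 'a) = of_bool (odd k)"
  by (induction k) (auto simp: char2)

lemma power2_add: "(x + y) ^ 2 = x ^ 2 + (y :: 'a) ^ 2"
  by (simp add: power2_sum)

lemma frob_add: "(x + y) ^ (2 ^ k) = x ^ (2 ^ k) + (y :: 'a) ^ (2 ^ k)"
  by (induction k) (simp_all add: power_mult power_mult[of _ 2, symmetric] power2_add
      mult.commute[of 2])

lemma frob_sum: "sum f S ^ (2 ^ k) = (\<Sum>i\<in>S. (f i :: 'a) ^ (2 ^ k))"
  by (induction S rule: infinite_finite_induct) (simp_all add: frob_add power_0_left)

lemma finite_F [simp]: "finite F"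
  using card_F card.infinite by fastforce

lemma F_closed [simp, intro]:
  "0 \<in> F" "1 \<in> F" "x \<in> F \<Longrightarrow> y \<in> F \<Longrightarrow> x + y \<in> F" "x \<in> F \<Longrightarrow> y \<in> F \<Longrightarrow> x * y \<in> F"
  "x \<in> F \<Longrightarrow> inverse x \<in> F"
  using subfield by (auto simp: is_subfield_def)

lemma F_divide [simp, intro]: "x \<in> F \<Longrightarrow> y \<in> F \<Longrightarrow> x / y \<in> F"
  by (simp add: divide_inverse)

lemma F_power [simp, intro]: "x \<in> F \<Longrightarrow> x ^ k \<in> F"
  by (induction k) auto

definition N :: nat where "N = 2 ^ n - 1"

lemma pow_n: "(2 :: nat) ^ n = Suc N"
  by (simp add: N_def)

lemma N_ge_3: "N \<ge> 3"
  using power_increasing[OF n_ge_2, of "2 :: nat"] by (simp add: N_def)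

lemma odd_N: "odd N"
  using n_ge_2 by (simp add: N_def)

lemma pow_less_N: "i < n \<Longrightarrow> (2 :: nat) ^ i < N"
proof -
  assume "i < n"
  hence "(2 :: nat) ^ Suc i \<le> 2 ^ n" by (intro power_increasing) auto
  thus ?thesis using N_ge_3 pow_n by simp
qed

lemma card_F_minus_0: "card (F - {0}) = N"
  by (simp add: card_F N_def)

lemma power_N:
  assumes "x \<in> F" "x \<noteq> 0"
  shows "x ^ N = 1"
proof -
  have "(\<Prod>y\<in>F-{0}. y) = (\<Prod>y\<in>F-{0}. x * y)"
    by (rule prod.reindex_bij_witness[of _ "\<lambda>y. x * y" "\<lambda>y. y / x"]) (use assms in auto)
  also have "\<dots> = x ^ N * (\<Prod>y\<in>F-{0}. y)"
    by (simp add: prod.distrib card_F_minus_0)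
  finally show ?thesis by simp
qed

lemma frob_n: "x \<in> F \<Longrightarrow> x ^ (2 ^ n) = x"
  using power_N[of x] by (cases "x = 0") (auto simp: pow_n)

lemma power_mod_N: "x \<in> F \<Longrightarrow> x \<noteq> 0 \<Longrightarrow> x ^ (k mod N) = x ^ k"
proof -
  assume x: "x \<in> F" "x \<noteq> 0"
  have "x ^ k = x ^ (N * (k div N) + k mod N)" by simp
  also have "\<dots> = x ^ (k mod N)" unfolding power_add power_mult using power_N[OF x] by simp
  finally show ?thesis ..
qed


text \<open>X^(2^n) + X has at most 2^n roots, and \<open>F\<close> already supplies that many. This
  criterion later puts r + r^q and r * r^q in \<open>F\<close>.\<close>

lemma mem_F_iff: "x \<in> F \<longleftrightarrow> x ^ (2 ^ n) = x"
proof
  assume "x ^ (2 ^ n) = x"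
  let ?p = "monom 1 (2 ^ n) + [:0, 1 :: 'a:]"
  have deg: "degree ?p = 2 ^ n"
    using pow_n N_ge_3 by (subst degree_add_eq_left) (simp_all add: degree_monom_eq)
  have nz: "?p \<noteq> 0" using deg by force
  have roots: "poly ?p y = 0 \<longleftrightarrow> y ^ (2 ^ n) = y" for y
    by (simp add: poly_monom add_eq_0_iff_eq)
  have "F = {y. poly ?p y = 0}"
  proof (rule card_seteq)
    show "finite {y. poly ?p y = 0}" using nz by (rule poly_roots_finite)
    show "F \<subseteq> {y. poly ?p y = 0}" unfolding roots using frob_n by blast
    show "card {y. poly ?p y = 0} \<le> card F"
      using card_poly_roots_bound[OF nz] by (simp add: deg card_F)
  qed
  thus "x \<in> F" using \<open>x ^ (2 ^ n) = x\<close> roots by blast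
qed (rule frob_n)

text \<open>A nonzero polynomial of degree \<open>k mod N\<close> cannot vanish at all
  \<open>N\<close> nonzero elements of \<open>F\<close>.\<close>

lemma ex_power_neq_1:
  assumes "\<not> N dvd k"
  obtains w where "w \<in> F" "w \<noteq> 0" "w ^ k \<noteq> 1"
proof -
  define l where "l = k mod N"
  have l: "0 < l" "l < N"
    using assms N_ge_3 by (auto simp: l_def dvd_eq_mod_eq_0)
  let ?p = "monom 1 l + [:1 :: 'a:]"
  have deg: "degree ?p = l"
    using l by (subst degree_add_eq_left) (simp_all add: degree_monom_eq)
  have nz: "?p \<noteq> 0" using deg l by force
  have "\<not> F - {0} \<subseteq> {y. poly ?p y = 0}"
  proof
    assume "F - {0} \<subseteq> {y. poly ?p y = 0}"
    hence "N \<le> card {y. poly ?p y = 0}"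
      using card_mono[OF poly_roots_finite[OF nz]] card_F_minus_0 by metis
    thus False using card_poly_roots_bound[OF nz] deg l by simp
  qed
  then obtain w where "w \<in> F" "w \<noteq> 0" "w ^ l \<noteq> 1"
    by (auto simp: poly_monom add_eq_0_iff_eq)
  thus ?thesis using that power_mod_N[of w k] by (simp add: l_def)
qed

text \<open>Scaling the variable by w with w^k \<noteq> 1 kills the sum over the nonzero elements.
  Leaving out the term at 1 then adds 1, which turns the indicator of \<open>N dvd k\<close> into
  its complement.\<close>

lemma power_sum: "(\<Sum>x\<in>F-{0,1}. x ^ k) = of_bool (\<not> N dvd k)"
proof -
  have "(\<Sum>x\<in>F-{0}. x ^ k) = of_bool (N dvd k)"
  proof (cases "N dvd k")
    case True
    have "(\<Sum>x\<in>F-{0}. x ^ k) = (\<Sum>x\<in>F-{0}. 1)"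
      using True by (intro sum.cong) (auto elim!: dvdE simp: power_mult power_N)
    thus ?thesis using True by (simp add: of_nat_eq_of_bool card_F_minus_0 odd_N)
  next
    case False
    then obtain w where w: "w \<in> F" "w \<noteq> 0" "w ^ k \<noteq> 1" by (rule ex_power_neq_1)
    have "(\<Sum>x\<in>F-{0}. x ^ k) = (\<Sum>x\<in>F-{0}. (w * x) ^ k)"
      by (rule sum.reindex_bij_witness[of _ "\<lambda>y. w * y" "\<lambda>y. y / w"]) (use w in auto)
    also have "\<dots> = w ^ k * (\<Sum>x\<in>F-{0}. x ^ k)"
      by (simp add: power_mult_distrib sum_distrib_left)
    finally have "(w ^ k - 1) * (\<Sum>x\<in>F-{0}. x ^ k) = 0"
      by (simp only: left_diff_distrib) simp
    thus ?thesis using w False by (auto simp: add_eq_0_iff_eq)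
  qed
  moreover have "(\<Sum>x\<in>F-{0}. x ^ k) = 1 + (\<Sum>x\<in>F-{0,1}. x ^ k)"
    by (subst sum.remove[of _ 1]) (auto simp: Diff_insert2[symmetric] insert_commute)
  ultimately show ?thesis
    by (metis (full_types) add_self_left add_self of_bool_eq(1) of_bool_eq(2) add_0_right)
qed

lemma inverse_power_N: "x \<in> F \<Longrightarrow> x \<noteq> 0 \<Longrightarrow> inverse x ^ k = x ^ (k * (N - 1))"
proof -
  assume x: "x \<in> F" "x \<noteq> 0"
  have "x * x ^ (N - 1) = 1"
    using power_N[OF x] N_ge_3 by (metis Suc_diff_1 less_le_trans power_Suc zero_less_numeral)
  hence "inverse x = x ^ (N - 1)" by (simp add: inverse_unique)
  thus ?thesis by (simp add: mult.commute flip: power_mult)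
qed

text \<open>On nonzero elements of \<open>F\<close> inversion is the power \<open>N - 1\<close>, so
  only k - l modulo \<open>N\<close> matters. Two natural exponents stand in for an integer
  one.\<close>

lemma laurent_sum:
  "(\<Sum>x\<in>F-{0,1}. x ^ k * inverse x ^ l) = of_bool (k mod N \<noteq> l mod N)"
proof -
  have "(\<Sum>x\<in>F-{0,1}. x ^ k * inverse x ^ l) = (\<Sum>x\<in>F-{0,1}. x ^ (k + l * (N - 1)))"
    by (intro sum.cong) (auto simp: inverse_power_N power_add)
  also have "N dvd k + l * (N - 1) \<longleftrightarrow> k mod N = l mod N"
  proof -
    obtain K where "N = Suc K" using N_ge_3 by (cases N) auto
    hence "int (k + l * (N - 1)) = int k - int l + int N * int l"
      by (simp add: algebra_simps)
    hence "N dvd k + l * (N - 1) \<longleftrightarrow> int N dvd int k - int l"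
      by (metis dvd_add_left_iff dvd_triv_left int_dvd_int_iff)
    also have "\<dots> \<longleftrightarrow> k mod N = l mod N"
      by (metis mod_eq_dvd_iff nat_int_comparison(1) zmod_int)
    finally show ?thesis .
  qed
  ultimately show ?thesis by (simp add: power_sum)
qed

end

subsection \<open>The trace and its pole sums\<close>

text \<open>This is the sum of v^(2^j) over the positions j of the binary ones of k. Consuming one
  digit per squaring of v makes it computable on numerals.\<close>

fun bit_sum :: "'a :: field \<Rightarrow> nat \<Rightarrow> 'a" where
  "bit_sum v k = (if k = 0 then 0 else (if odd k then v else 0) + bit_sum (v ^ 2) (k div 2))"

declare bit_sum.simps [simp del]

lemma bit_sum_0 [simp]: "bit_sum v 0 = 0"
  by (simp add: bit_sum.simps)

lemma bit_sum_altdef: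
  "k < 2 ^ n \<Longrightarrow> bit_sum v k = (\<Sum>j<n. of_bool (odd (k div 2 ^ j)) * v ^ (2 ^ j))"
proof (induction n arbitrary: k v)
  case (Suc n)
  have "bit_sum v k = of_bool (odd k) * v + bit_sum (v ^ 2) (k div 2)"
    by (subst bit_sum.simps) auto
  also have "bit_sum (v ^ 2) (k div 2) =
      (\<Sum>j<n. of_bool (odd (k div 2 div 2 ^ j)) * (v ^ 2) ^ (2 ^ j))"
    using Suc.prems by (intro Suc.IH) auto
  finally show ?case
    by (simp add: sum.lessThan_Suc_shift div_mult2_eq flip: power_mult del: sum.lessThan_Suc)
qed auto

text \<open>Low and high digits contribute separately. With blocks of five digits this isolates the
  unknown high part of a large power of two.\<close>

lemma bit_sum_split:
  "r < 2 ^ k \<Longrightarrow> bit_sum v (2 ^ k * u + r) = bit_sum v r + bit_sum (v ^ (2 ^ k)) u"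
proof (induction k arbitrary: v r)
  case (Suc k)
  have "bit_sum v (2 ^ Suc k * u + r) =
      of_bool (odd r) * v + bit_sum (v ^ 2) ((2 ^ Suc k * u + r) div 2)"
    by (subst bit_sum.simps) auto
  also have "(2 ^ Suc k * u + r) div 2 = 2 ^ k * u + r div 2"
    by simp
  also have "bit_sum (v ^ 2) \<dots> = bit_sum (v ^ 2) (r div 2) + bit_sum ((v ^ 2) ^ 2 ^ k) u"
    using Suc.prems by (intro Suc.IH) auto
  also have "of_bool (odd r) * v + \<dots> = bit_sum v r + bit_sum (v ^ (2 ^ Suc k)) u"
    by (subst bit_sum.simps[of v r]) (auto simp flip: power_mult)
  finally show ?case .
qed auto

context char2_subfield
begin

definition T :: "'a \<Rightarrow> 'a" where "T x = (\<Sum>i<n. x ^ (2 ^ i))"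

lemma T_0 [simp]: "T 0 = 0"
  by (simp add: T_def power_0_left)

lemma T_add: "T (x + y) = T x + T y"
  by (simp add: T_def frob_add sum.distrib)

lemma T_square: "x \<in> F \<Longrightarrow> T (x ^ 2) = T x"
proof -
  assume x: "x \<in> F"
  have "(\<Sum>i<Suc n. x ^ (2 ^ i)) = x + T (x ^ 2)"
    by (subst sum.lessThan_Suc_shift) (simp add: T_def flip: power_mult)
  hence "T x + x = x + T (x ^ 2)" using frob_n[OF x] by (simp add: T_def)
  thus ?thesis by (metis add.commute add_left_cancel)
qed

lemma T_cases: "x \<in> F \<Longrightarrow> T x = 0 \<or> T x = 1"
proof -
  assume x: "x \<in> F"
  have "T x ^ 2 = T x"
    using frob_sum[of "\<lambda>i. x ^ (2 ^ i)" "{..<n}" 1] T_square[OF x]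
    by (simp add: T_def mult.commute flip: power_mult)
  hence "T x * (T x + 1) = 0"
    by (simp only: power2_eq_square distrib_left mult_1_right add_self)
  thus ?thesis unfolding mult_eq_0_iff add_eq_0_iff_eq .
qed

text \<open>Additive Hilbert 90 by counting. The map x^2 + x is at most two-to-one on
  \<open>F\<close>, so its image has at least 2^(n-1) elements. The trace vanishes on that image
  and, as a nonzero polynomial of degree at most 2^(n-1), has no further zeros.\<close>

lemma T_eq_0_imp:
  assumes "w \<in> F" "T w = 0"
  obtains x where "x \<in> F" "x ^ 2 + x = w"
proof -
  let ?h = "\<lambda>x :: 'a. x ^ 2 + x"
  let ?p = "\<Sum>i<n. monom (1 :: 'a) (2 ^ i)"
  obtain n' where n': "n = Suc n'" using n_ge_2 by (cases n) auto
  have poly_p: "poly ?p x = T x" for x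
    by (simp add: T_def poly_sum poly_monom)
  have "coeff ?p (2 ^ n') = 1"
    by (simp add: coeff_sum n')
  hence nz: "?p \<noteq> 0" by force
  have "degree ?p \<le> 2 ^ n'"
    by (rule degree_sum_le) (auto simp: degree_monom_eq n')
  hence "card {x. T x = 0} \<le> 2 ^ n'"
    using card_poly_roots_bound[OF nz] by (simp add: poly_p)
  moreover have fin: "finite {x. T x = 0}"
    using poly_roots_finite[OF nz] by (simp add: poly_p)
  moreover have "2 ^ n' \<le> card (?h ` F)"
  proof -
    have fibre: "card {x\<in>F. ?h x = ?h y} \<le> 2" for y
    proof -
      have "?h x = ?h y \<Longrightarrow> x = y \<or> x = y + 1" for x
      proof -
        assume "?h x = ?h y"
        have "(x + y) * (x + y + 1) = ?h x + ?h y"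
          by (simp add: algebra_simps power2_eq_square)
        also have "\<dots> = 0" by (simp only: \<open>?h x = ?h y\<close> add_self)
        finally have "x + y = 0 \<or> x + (y + 1) = 0" by (simp add: add.assoc)
        thus ?thesis unfolding add_eq_0_iff_eq .
      qed
      hence "{x\<in>F. ?h x = ?h y} \<subseteq> {y, y + 1}" by blast
      hence "card {x\<in>F. ?h x = ?h y} \<le> card {y, y + 1}" by (intro card_mono) auto
      thus ?thesis by simp
    qed
    have "F = (\<Union>w\<in>?h ` F. {x\<in>F. ?h x = w})" by auto
    hence "card F = card (\<Union>w\<in>?h ` F. {x\<in>F. ?h x = w})" by (rule arg_cong[of _ _ card])
    also have "\<dots> \<le> (\<Sum>w\<in>?h ` F. card {x\<in>F. ?h x = w})"
      by (rule card_UN_le[OF finite_imageI[OF finite_F]])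
    also have "\<dots> \<le> (\<Sum>w\<in>?h ` F. 2)"
    proof (rule sum_mono)
      fix w assume "w \<in> ?h ` F"
      then obtain y where "w = ?h y" by blast
      thus "card {x\<in>F. ?h x = w} \<le> 2" using fibre by blast
    qed
    finally have "card F \<le> card (?h ` F) * 2" by (simp only: sum_constant of_nat_id)
    thus ?thesis unfolding card_F n' by simp
  qed
  moreover have "?h ` F \<subseteq> {x. T x = 0}"
  proof
    fix w assume "w \<in> ?h ` F"
    then obtain x where x: "x \<in> F" "w = ?h x" by blast
    show "w \<in> {x. T x = 0}" unfolding x(2) mem_Collect_eq T_add T_square[OF x(1)] by (rule add_self)
  qed
  ultimately have "?h ` F = {x. T x = 0}"
    using card_seteq[of "{x. T x = 0}" "?h ` F"] by linarith
  moreover have "w \<in> {x. T x = 0}" using assms(2) by simp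
  ultimately have "w \<in> ?h ` F" by (rule back_subst[of "\<lambda>S. w \<in> S", OF _ sym, rotated])
  then obtain x where "w = ?h x" "x \<in> F" by (rule imageE)
  thus ?thesis using that[of x] by simp
qed

definition pole_sum :: "nat \<Rightarrow> nat \<Rightarrow> 'a" where
  "pole_sum k e = (\<Sum>x\<in>F-{0,1}. x ^ k * inverse (1 + x) ^ e)"

text \<open>Write one factor x as (1 + x) + 1 and cancel 1 + x in one summand.\<close>

lemma pole_sum_Suc: "pole_sum (Suc k) (Suc e) = pole_sum k (Suc e) + pole_sum k e"
proof -
  have "x ^ Suc k * inverse (1 + x) ^ Suc e =
      x ^ k * inverse (1 + x) ^ Suc e + x ^ k * inverse (1 + x) ^ e" if "x \<noteq> 1" for x :: 'a
  proof -
    have "1 + x \<noteq> 0" using that by (auto simp: add_eq_0_iff_eq)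
    hence "inverse (1 + x) * (1 + x) = 1" by simp
    have "x ^ Suc k * inverse (1 + x) ^ Suc e + x ^ k * inverse (1 + x) ^ Suc e
        = x ^ k * inverse (1 + x) ^ e * (inverse (1 + x) * (1 + x))"
      by (simp add: algebra_simps)
    also have "\<dots> = x ^ k * inverse (1 + x) ^ e" using \<open>inverse (1 + x) * (1 + x) = 1\<close> by simp
    finally show ?thesis by (metis add.commute add_self_left)
  qed
  thus ?thesis unfolding pole_sum_def sum.distrib[symmetric] by (intro sum.cong) auto
qed

lemma pole_sum_0:
  assumes "0 < e" "e < N"
  shows "pole_sum 0 e = 1"
proof -
  have "pole_sum 0 e = (\<Sum>z\<in>F-{0,1}. z ^ 0 * inverse z ^ e)"
    unfolding pole_sum_def
    by (rule sum.reindex_bij_witness[of _ "\<lambda>z. 1 + z" "\<lambda>z. 1 + z"]) (auto simp: add_eq_0_iff_eq)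
  thus ?thesis using assms by (simp only: laurent_sum) simp
qed

text \<open>At k = 1 the recursion adds two values of \<open>pole_sum 0\<close>, both equal to 1,
  which cancel; the zero then propagates to larger k.\<close>

lemma pole_sum_less:
  assumes "0 < k" "k < e" "e < N"
  shows "pole_sum k e = 0"
  using assms
proof (induction k arbitrary: e)
  case (Suc k)
  then obtain e' where e': "e = Suc e'" by (cases e) auto
  show ?case
  proof (cases "k = 0")
    case True
    thus ?thesis using Suc.prems by (simp add: e' pole_sum_Suc pole_sum_0)
  next
    case False
    thus ?thesis using Suc.prems Suc.IH[of e] Suc.IH[of e'] by (simp add: e' pole_sum_Suc)
  qed
qed auto

text \<open>By Frobenius the denominator is 1 + x^(2^j), so raising the numerator exponent by 2^j
  changes the sum by a plain power sum.\<close>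

lemma pole_sum_add:
  "pole_sum (k + 2 ^ j) (2 ^ j) = pole_sum k (2 ^ j) + of_bool (\<not> N dvd k)"
proof -
  have "x ^ (k + 2 ^ j) * inverse (1 + x) ^ (2 ^ j) = x ^ k * inverse (1 + x) ^ (2 ^ j) + x ^ k"
    if "x \<noteq> 1" for x :: 'a
  proof -
    have "1 + x \<noteq> 0" using that by (auto simp: add_eq_0_iff_eq)
    hence "inverse (1 + x) ^ (2 ^ j) * (1 + x) ^ (2 ^ j) = 1" by (simp flip: power_mult_distrib)
    hence 1: "inverse (1 + x) ^ (2 ^ j) * (1 + x ^ (2 ^ j)) = 1" by (simp add: frob_add)
    have "x ^ (k + 2 ^ j) * inverse (1 + x) ^ (2 ^ j) + x ^ k * inverse (1 + x) ^ (2 ^ j)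
        = x ^ k * (inverse (1 + x) ^ (2 ^ j) * (1 + x ^ (2 ^ j)))"
      by (simp add: algebra_simps power_add)
    also have "\<dots> = x ^ k" unfolding 1 by simp
    finally show ?thesis by (metis add.commute add_self_left)
  qed
  thus ?thesis unfolding pole_sum_def power_sum[symmetric] sum.distrib[symmetric]
    by (intro sum.cong) auto
qed

text \<open>Each step of length 2^j toggles the sum, so it records the parity of the number of
  steps, which is digit j of k. The step between 0 and 2^j does not toggle: there the power sum is 0
  and both values are 1.\<close>

lemma pole_sum_pow2:
  assumes "j < n" "0 < k" "k \<le> N"
  shows "pole_sum k (2 ^ j) = of_bool (odd (k div 2 ^ j))"
  using assms(2,3)
proof (induction k rule: less_induct)
  case (less k)
  consider "k < 2 ^ j" | "k = 2 ^ j" | "k > 2 ^ j" by linarith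
  thus ?case
  proof cases
    case 1
    thus ?thesis using less.prems pow_less_N[OF assms(1)] by (simp add: pole_sum_less)
  next
    case 2
    thus ?thesis using pole_sum_add[of 0 j] pow_less_N[OF assms(1)] by (simp add: pole_sum_0)
  next
    case 3
    define k' where "k' = k - 2 ^ j"
    have "(2 :: nat) ^ j > 0" by simp
    hence k: "k = k' + 2 ^ j" and k': "0 < k'" "k' < N" "k' < k"
      using 3 less.prems unfolding k'_def by linarith+
    have "\<not> N dvd k'" using k' by (auto dest: dvd_imp_le)
    thus ?thesis using less.IH[of k'] k' by (simp add: k pole_sum_add char2)
  qed
qed

lemma trace_pole_sum:
  assumes "0 < k" "k \<le> N"
  shows "(\<Sum>x\<in>F-{0,1}. x ^ k * T (v * inverse (1 + x))) = bit_sum v k"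
proof -
  have "(\<Sum>x\<in>F-{0,1}. x ^ k * T (v * inverse (1 + x))) =
      (\<Sum>x\<in>F-{0,1}. \<Sum>j<n. v ^ (2 ^ j) * (x ^ k * inverse (1 + x) ^ (2 ^ j)))"
    by (simp add: T_def sum_distrib_left power_mult_distrib mult_ac)
  also have "\<dots> = (\<Sum>j<n. v ^ (2 ^ j) * pole_sum k (2 ^ j))"
    by (subst sum.swap) (simp add: pole_sum_def sum_distrib_left)
  also have "\<dots> = (\<Sum>j<n. of_bool (odd (k div 2 ^ j)) * v ^ (2 ^ j))"
    using assms by (intro sum.cong) (auto simp: pole_sum_pow2)
  also have "\<dots> = bit_sum v k"
    using assms pow_n by (intro bit_sum_altdef[symmetric]) auto
  finally show ?thesis .
qed

lemma bit_sum_N: "bit_sum v N = T v"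
proof -
  have "odd (N div 2 ^ j)" if "j < n" for j
  proof -
    have "(2 :: nat) ^ n = 2 ^ j * 2 ^ (n - j)" using that by (simp flip: power_add)
    moreover obtain c where "(2 :: nat) ^ (n - j) = 2 * c" "c > 0"
    proof -
      obtain k where "n - j = Suc k" using \<open>j < n\<close> by (cases "n - j") auto
      thus ?thesis using that[of "2 ^ k"] by simp
    qed
    \<comment> \<open>Digit j of \<open>N\<close> appears as the lowest digit of the odd
      factor.\<close>
    ultimately have N_eq: "N = 2 ^ j * (2 * (c - 1) + 1) + (2 ^ j - 1)"
      by (cases c) (auto simp: N_def algebra_simps)
    have "N div 2 ^ j = 2 * (c - 1) + 1"
      by (subst N_eq, subst div_mult_self4) simp_all
    thus ?thesis by simp
  qed
  thus ?thesis using pow_n by (subst bit_sum_altdef[of _ n]) (auto simp: T_def)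
qed

text \<open>The hypothesis on T v serves twice. It makes \<open>bit_sum v 0\<close> and
  \<open>bit_sum v N\<close> agree, so exponents may be reduced modulo \<open>N\<close>. It also
  makes the trace invariant under x -> 1/x, which sends v/(1+x) to v + v/(1+x) and reverses the sign
  of the exponent.\<close>

lemma trace_pole_sum_diff:
  assumes "T v = 0"
  shows "l \<le> k \<Longrightarrow> (\<Sum>x\<in>F-{0,1}. x ^ k * inverse x ^ l * T (v * inverse (1 + x))) =
           bit_sum v ((k - l) mod N)"
    and "k \<le> l \<Longrightarrow> l - k < N \<Longrightarrow>
           (\<Sum>x\<in>F-{0,1}. x ^ k * inverse x ^ l * T (v * inverse (1 + x))) = bit_sum v (l - k)"
proof -
  have *: "(\<Sum>x\<in>F-{0,1}. x ^ e * T (v * inverse (1 + x))) = bit_sum v (e mod N)" for e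
  proof (cases "e mod N = 0")
    case False
    have "(\<Sum>x\<in>F-{0,1}. x ^ e * T (v * inverse (1 + x))) =
        (\<Sum>x\<in>F-{0,1}. x ^ (e mod N) * T (v * inverse (1 + x)))"
      by (intro sum.cong) (auto simp: power_mod_N)
    also have "\<dots> = bit_sum v (e mod N)"
      using False N_ge_3 by (intro trace_pole_sum) (auto simp: less_imp_le)
    finally show ?thesis .
  next
    case True
    have "x ^ e = x ^ N" if "x \<in> F" "x \<noteq> 0" for x
      using power_mod_N[OF that, of e] power_N[OF that] True by simp
    hence "(\<Sum>x\<in>F-{0,1}. x ^ e * T (v * inverse (1 + x))) =
        (\<Sum>x\<in>F-{0,1}. x ^ N * T (v * inverse (1 + x)))"
      by (intro sum.cong) auto
    also have "\<dots> = bit_sum v N"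
      using N_ge_3 by (intro trace_pole_sum) auto
    finally show ?thesis using True assms by (simp add: bit_sum_N)
  qed
  {
    assume "l \<le> k"
    hence "x ^ k * inverse x ^ l = x ^ (k - l)" if "x \<noteq> 0" for x :: 'a
      using that by (simp add: power_diff field_simps)
    hence "(\<Sum>x\<in>F-{0,1}. x ^ k * inverse x ^ l * T (v * inverse (1 + x))) =
        (\<Sum>x\<in>F-{0,1}. x ^ (k - l) * T (v * inverse (1 + x)))"
      by (intro sum.cong) auto
    thus "(\<Sum>x\<in>F-{0,1}. x ^ k * inverse x ^ l * T (v * inverse (1 + x))) =
           bit_sum v ((k - l) mod N)" by (simp only: *)
  }
  assume kl: "k \<le> l" "l - k < N"
  have "(\<Sum>x\<in>F-{0,1}. x ^ k * inverse x ^ l * T (v * inverse (1 + x))) =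
      (\<Sum>x\<in>F-{0,1}. x ^ (l - k) * T (v * inverse (1 + x)))"
  proof (rule sum.reindex_bij_witness[of _ inverse inverse])
    fix x assume x: "x \<in> F - {0, 1}"
    have nz: "1 + x \<noteq> 0" "x \<noteq> 0" using x by (auto simp: add_eq_0_iff_eq)
    have "inverse x ^ (l - k) = x ^ k * inverse x ^ l"
      using kl nz by (simp add: power_diff field_simps)
    moreover have "v * inverse (1 + inverse x) = v + v * inverse (1 + x)"
      using nz add_eq_0_iff_eq[of 1 "inverse x"] by (simp add: field_simps)
    ultimately show "inverse x ^ (l - k) * T (v * inverse (1 + inverse x)) =
        x ^ k * inverse x ^ l * T (v * inverse (1 + x))"
      by (simp add: T_add assms)
  qed auto
  thus "(\<Sum>x\<in>F-{0,1}. x ^ k * inverse x ^ l * T (v * inverse (1 + x))) = bit_sum v (l - k)"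
    using kl by (simp add: *)
qed

subsection \<open>Coefficients of a product of two traces\<close>

text \<open>
  In the last sum a negative exponent \<open>M - 2\<^sup>i\<close> is replaced by its absolute value: this is
  legitimate because \<open>x \<mapsto> 1 / x\<close> leaves \<open>T (\<nu> / (1 + x))\<close> invariant when \<open>T \<nu> = 0\<close>.
\<close>
definition coeff_rel :: "'a \<Rightarrow> 'a \<Rightarrow> 'a \<Rightarrow> 'a \<Rightarrow> nat \<Rightarrow> 'a" where
  "coeff_rel \<alpha> \<beta> \<delta> \<nu> M =
     (\<Sum>i<n. \<Sum>j<n. \<alpha> ^ (2 ^ i) * \<delta> ^ (2 ^ j) * of_bool ((M + 2 ^ i) mod N = 2 ^ j)) +
     (\<Sum>i<n. \<Sum>j<n. \<beta> ^ (2 ^ i) * \<delta> ^ (2 ^ j) * of_bool (M mod N = (2 ^ i + 2 ^ j) mod N)) +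
     (\<Sum>i<n. \<alpha> ^ (2 ^ i) * bit_sum \<nu> ((M + 2 ^ i) mod N)) +
     (\<Sum>i<n. \<beta> ^ (2 ^ i) * bit_sum \<nu> (if 2 ^ i \<le> M then (M - 2 ^ i) mod N else 2 ^ i - M))"

lemma coeff_rel_eq:
  assumes zero: "\<And>x. x \<in> F \<Longrightarrow> x \<noteq> 0 \<Longrightarrow> x \<noteq> 1 \<Longrightarrow>
      T (\<alpha> * x + \<beta> * inverse x) * T (\<delta> * inverse x + \<nu> * inverse (1 + x)) = 0"
    and \<nu>: "T \<nu> = 0"
  shows "coeff_rel \<alpha> \<beta> \<delta> \<nu> M = T (\<alpha> + \<beta>) * T \<delta>"
proof -
  define W where "W x = T (\<delta> * inverse x + \<nu> * inverse (1 + x))" for x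
  define U where "U k l = (\<Sum>x\<in>F-{0,1}. x ^ k * inverse x ^ l * W x)" for k l
  have of_bool_not: "of_bool (\<not> b) = (1 + of_bool b :: 'a)" for b
    by (cases b) (auto simp: char2)
  have U: "U k l = T \<delta> + (\<Sum>j<n. \<delta> ^ (2 ^ j) * of_bool (k mod N = (l + 2 ^ j) mod N)) +
      (\<Sum>x\<in>F-{0,1}. x ^ k * inverse x ^ l * T (\<nu> * inverse (1 + x)))" for k l
  proof -
    have "(\<Sum>x\<in>F-{0,1}. x ^ k * inverse x ^ l * T (\<delta> * inverse x)) =
        (\<Sum>x\<in>F-{0,1}. \<Sum>j<n. \<delta> ^ (2 ^ j) * (x ^ k * inverse x ^ (l + 2 ^ j)))"
      by (simp add: T_def sum_distrib_left power_mult_distrib power_add mult_ac)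
    also have "\<dots> = (\<Sum>j<n. \<delta> ^ (2 ^ j) * of_bool (k mod N \<noteq> (l + 2 ^ j) mod N))"
      by (subst sum.swap) (simp only: laurent_sum flip: sum_distrib_left)
    also have "\<dots> = T \<delta> + (\<Sum>j<n. \<delta> ^ (2 ^ j) * of_bool (k mod N = (l + 2 ^ j) mod N))"
      by (simp only: of_bool_not distrib_left sum.distrib T_def mult_1_right)
    finally show ?thesis
      by (simp add: U_def W_def T_add distrib_left sum.distrib)
  qed
  \<comment> \<open>Expanding only the first trace leaves Laurent monomials times
    \<open>W x\<close>, whose sums are the \<open>U k l\<close>.\<close>
  have "0 = (\<Sum>x\<in>F-{0,1}. x ^ M * (T (\<alpha> * x + \<beta> * inverse x) * W x))"
    using zero by (intro sum.neutral[symmetric]) (auto simp: W_def)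
  also have "\<dots> = (\<Sum>x\<in>F-{0,1}. \<Sum>i<n. \<alpha> ^ (2 ^ i) * (x ^ (M + 2 ^ i) * inverse x ^ 0 * W x) +
      \<beta> ^ (2 ^ i) * (x ^ M * inverse x ^ (2 ^ i) * W x))"
    by (intro sum.cong refl)
      (simp add: T_def sum_distrib_left sum_distrib_right frob_add power_mult_distrib power_add
        algebra_simps sum.distrib)
  also have "\<dots> = (\<Sum>i<n. \<alpha> ^ (2 ^ i) * U (M + 2 ^ i) 0 + \<beta> ^ (2 ^ i) * U M (2 ^ i))"
    by (subst sum.swap) (simp only: U_def sum.distrib sum_distrib_left)
  also have "\<dots> = (\<Sum>i<n. \<alpha> ^ (2 ^ i) * T \<delta> + \<beta> ^ (2 ^ i) * T \<delta> +
      ((\<Sum>j<n. \<alpha> ^ (2 ^ i) * \<delta> ^ (2 ^ j) * of_bool ((M + 2 ^ i) mod N = 2 ^ j)) +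
       (\<Sum>j<n. \<beta> ^ (2 ^ i) * \<delta> ^ (2 ^ j) * of_bool (M mod N = (2 ^ i + 2 ^ j) mod N)) +
       \<alpha> ^ (2 ^ i) * bit_sum \<nu> ((M + 2 ^ i) mod N) +
       \<beta> ^ (2 ^ i) * bit_sum \<nu> (if 2 ^ i \<le> M then (M - 2 ^ i) mod N else 2 ^ i - M)))"
    (is "_ = (\<Sum>i<n. ?R i)")
  proof (intro sum.cong refl)
    fix i assume "i \<in> {..<n}"
    hence i: "2 ^ i < N" by (simp add: pow_less_N)
    have "(2 :: nat) ^ j mod N = 2 ^ j" if "j < n" for j
      using that pow_less_N by simp
    hence 1: "(\<Sum>j<n. \<delta> ^ (2 ^ j) * of_bool ((M + 2 ^ i) mod N = (0 + 2 ^ j) mod N)) =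
        (\<Sum>j<n. \<delta> ^ (2 ^ j) * of_bool ((M + 2 ^ i) mod N = 2 ^ j))"
      by (intro sum.cong) auto
    have 2: "(\<Sum>x\<in>F-{0,1}. x ^ (M + 2 ^ i) * inverse x ^ 0 * T (\<nu> * inverse (1 + x))) =
        bit_sum \<nu> ((M + 2 ^ i) mod N)"
      using trace_pole_sum_diff(1)[OF \<nu>, of 0 "M + 2 ^ i"] by simp
    have 3: "(\<Sum>x\<in>F-{0,1}. x ^ M * inverse x ^ (2 ^ i) * T (\<nu> * inverse (1 + x))) =
        bit_sum \<nu> (if 2 ^ i \<le> M then (M - 2 ^ i) mod N else 2 ^ i - M)"
      using trace_pole_sum_diff[OF \<nu>] i by auto
    show "\<alpha> ^ (2 ^ i) * U (M + 2 ^ i) 0 + \<beta> ^ (2 ^ i) * U M (2 ^ i) = ?R i"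
      unfolding U 1 2 3 distrib_left sum_distrib_left by (simp only: ac_simps)
  qed
  also have "\<dots> = T (\<alpha> + \<beta>) * T \<delta> + coeff_rel \<alpha> \<beta> \<delta> \<nu> M"
    by (simp only: coeff_rel_def sum.distrib T_def frob_add sum_distrib_right distrib_right add_ac)
  finally show ?thesis by (simp add: add_eq_0_iff_eq)
qed

end

section \<open>Carries and borrows at small exponents, and the case \<open>B\<close> nonzero\<close>

lemma bit_sum_numeral [simp]:
  "bit_sum v 1 = v" "bit_sum v (Suc 0) = v"
  "bit_sum v (numeral (Num.Bit0 k)) = bit_sum (v ^ 2) (numeral k)"
  "bit_sum v (numeral (Num.Bit1 k)) = v + bit_sum (v ^ 2) (numeral k)"
  by (subst bit_sum.simps, simp add: numeral_Bit0_div_2 numeral_Bit1_div_2)+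

lemma bit_sum_of_0 [simp]: "bit_sum (0 :: 'a :: field) k = 0"
  by (induction k rule: less_induct) (subst bit_sum.simps, auto)

text \<open>Beyond five small exponents a power of two is a multiple of 32, so equations among
  powers of two reduce to finite checks modulo 32. The form c + 1 keeps c available as the high
  block after a borrow.\<close>

lemma pow2_cases:
  fixes k :: nat
  obtains "k = 0" | "k = 1" | "k = 2" | "k = 3" | "k = 4"
  | c :: nat where "k \<ge> 5" "(2 :: nat) ^ k = 32 * (c + 1)"
proof -
  have "k < 5 \<or> (\<exists>c. k = c + 5)" by presburger
  thus ?thesis
  proof
    assume "k < 5"
    hence "k = 0 \<or> k = 1 \<or> k = 2 \<or> k = 3 \<or> k = 4" by presburger
    thus ?thesis using that(1-5) by blast
  next
    assume "\<exists>c. k = c + 5"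
    then obtain c where "k = c + 5" ..
    hence "k \<ge> 5" "(2 :: nat) ^ k = 32 * (2 ^ c - 1 + 1)" by (simp_all add: power_add)
    thus ?thesis by (rule that(6))
  qed
qed

lemma pow2_mod_32: "(2 :: nat) ^ k mod 32 \<in> {0, 1, 2, 4, 8, 16}"
  by (cases k rule: pow2_cases) simp_all

lemma sum_delta2:
  assumes "a < n" "b < (n :: nat)"
  shows "(\<Sum>i<n. \<Sum>j<n. f i j * of_bool (i = a \<and> j = b)) = (f a b :: 'a :: field)"
proof -
  have "(\<Sum>i<n. \<Sum>j<n. f i j * of_bool (i = a \<and> j = b)) =
      (\<Sum>i<n. if i = a then (\<Sum>j<n. if j = b then f a b else 0) else 0)"
    by (intro sum.cong refl) auto
  thus ?thesis using assms by simp
qed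

context char2_subfield
begin

text \<open>The upper bound on M prevents M + 2^i from wrapping modulo \<open>N\<close>. Only 2^i +
  2^j can wrap, to residue 0 or 1, and the lower bound keeps M away from both.\<close>

lemma coeff_rel_small:
  assumes M: "2 \<le> M" "M + 1 < 2 ^ (n - 1)"
  shows "coeff_rel \<alpha> \<beta> \<delta> \<nu> M =
     (\<Sum>i<n. \<Sum>j<n. \<alpha> ^ (2 ^ i) * \<delta> ^ (2 ^ j) * of_bool (M + 2 ^ i = 2 ^ j)) +
     (\<Sum>i<n. \<Sum>j<n. \<beta> ^ (2 ^ i) * \<delta> ^ (2 ^ j) * of_bool (M = 2 ^ i + 2 ^ j)) +
     (\<Sum>i<n. \<alpha> ^ (2 ^ i) * bit_sum \<nu> (M + 2 ^ i)) +
     (\<Sum>i<n. \<beta> ^ (2 ^ i) * bit_sum \<nu> (if 2 ^ i \<le> M then M - 2 ^ i else 2 ^ i - M))"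
proof -
  have half: "(2 :: nat) ^ i \<le> 2 ^ (n - 1)" if "i < n" for i
    using that by (intro power_increasing) auto
  have N: "N = 2 * 2 ^ (n - 1) - 1"
    unfolding N_def using n_ge_2 by (cases n) auto
  have 1: "(M + 2 ^ i) mod N = M + 2 ^ i" if "i < n" for i
  proof -
    have "M + 2 ^ i < N" using half[OF that] M N by linarith
    thus ?thesis by simp
  qed
  have 2: "M mod N = (2 ^ i + 2 ^ j) mod N \<longleftrightarrow> M = 2 ^ i + 2 ^ j" if "i < n" "j < n" for i j
  proof -
    have "M mod N = M" using M N by simp
    consider "2 ^ i + 2 ^ j < N" | "2 ^ i + 2 ^ j = N" | "2 ^ i + 2 ^ j = N + 1"
      using half[OF \<open>i < n\<close>] half[OF \<open>j < n\<close>] N by linarith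
    thus ?thesis
    proof cases
      case 3
      have "(N + 1) mod N = 1" using N_ge_3 by (simp add: mod_if)
      thus ?thesis using 3 M N \<open>M mod N = M\<close> by simp
    qed (use M N \<open>M mod N = M\<close> in auto)
  qed
  have 3: "(M - 2 ^ i) mod N = M - 2 ^ i" for i
    using M N by simp
  show ?thesis unfolding coeff_rel_def
    by (intro arg_cong2[of _ _ _ _ plus] sum.cong refl) (auto simp: 1 2 3)
qed

text \<open>Each of these M has three binary ones, not all adjacent, so it is neither a sum nor a
  difference of two powers of two and both double sums vanish. The bound n \<ge> 6 gives 21 + 1 <
  2^(n-1).\<close>

lemma coeff_rel_no_carry:
  assumes "n \<ge> 6" "M \<in> {11, 13, 19, 21}"
  shows "coeff_rel \<alpha> \<beta> \<delta> \<nu> M =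
     (\<Sum>i<n. \<alpha> ^ (2 ^ i) * bit_sum \<nu> (M + 2 ^ i)) +
     (\<Sum>i<n. \<beta> ^ (2 ^ i) * bit_sum \<nu> (if 2 ^ i \<le> M then M - 2 ^ i else 2 ^ i - M))"
proof -
  have "(2 :: nat) ^ 5 \<le> 2 ^ (n - 1)" using assms by (intro power_increasing) auto
  hence small: "2 \<le> M" "M + 1 < 2 ^ (n - 1)" using assms(2) by auto
  have 1: "M + 2 ^ i \<noteq> 2 ^ j" for i j
  proof
    assume "M + 2 ^ i = 2 ^ j"
    hence "(M + 2 ^ i mod 32) mod 32 = 2 ^ j mod 32" by (metis mod_add_right_eq)
    thus False using pow2_mod_32[of i] pow2_mod_32[of j] assms(2) by auto
  qed
  have 2: "M \<noteq> 2 ^ i + 2 ^ j" for i j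
  proof
    assume "M = 2 ^ i + 2 ^ j"
    hence "M mod 32 = (2 ^ i mod 32 + 2 ^ j mod 32) mod 32" by (metis mod_add_eq)
    thus False using pow2_mod_32[of i] pow2_mod_32[of j] assms(2) by auto
  qed
  show ?thesis unfolding coeff_rel_small[OF small] using 1 2 by simp
qed

text \<open>
  The four exponents are \<open>1 + 2 ^ s + 2 ^ t\<close> with \<open>s \<in> {1, 2}\<close> and \<open>t \<in> {3, 4}\<close>: the alternating
  sum leaves only the carry from position 2 into position 3.
\<close>
lemma coeff_rel_alternating:
  assumes "n \<ge> 6"
  shows "coeff_rel \<alpha> \<beta> \<delta> \<nu> 11 + coeff_rel \<alpha> \<beta> \<delta> \<nu> 13 + coeff_rel \<alpha> \<beta> \<delta> \<nu> 19 + coeff_rel \<alpha> \<beta> \<delta> \<nu> 21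
    = (\<alpha> + \<beta>) ^ 4 * \<nu> ^ 16"
proof -
  let ?D = "\<lambda>M i. if 2 ^ i \<le> M then M - 2 ^ i else 2 ^ i - M :: nat"
  have a: "bit_sum \<nu> (11 + 2 ^ i) + bit_sum \<nu> (13 + 2 ^ i) + bit_sum \<nu> (19 + 2 ^ i) +
      bit_sum \<nu> (21 + 2 ^ i) = (if i = 2 then \<nu> ^ 16 else 0)" for i
  proof (cases i rule: pow2_cases)
    case (6 c)
    have split: "bit_sum \<nu> (r + 2 ^ i) = bit_sum \<nu> r + bit_sum (\<nu> ^ 32) (c + 1)" if "r < 32" for r
      using bit_sum_split[of r 5 \<nu> "c + 1"] that by (simp add: 6 add_ac)
    show ?thesis using 6(1) by (simp add: split; simp add: ac_simps)
  qed (simp_all add: ac_simps flip: power_mult)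
  have b: "bit_sum \<nu> (?D 11 i) + bit_sum \<nu> (?D 13 i) + bit_sum \<nu> (?D 19 i) + bit_sum \<nu> (?D 21 i)
      = (if i = 2 then \<nu> ^ 16 else 0)" for i
  proof (cases i rule: pow2_cases)
    case (6 c)
    \<comment> \<open>Subtracting r from 32 (c + 1) borrows one from the high block, leaving c above
      and 32 - r below.\<close>
    have split: "bit_sum \<nu> (?D r i) = bit_sum \<nu> (32 - r) + bit_sum (\<nu> ^ 32) c" if "0 < r" "r < 32" for r
    proof -
      have "?D r i = 2 ^ 5 * c + (32 - r)" using that 6 by simp
      thus ?thesis using bit_sum_split[of "32 - r" 5 \<nu> c] that by simp
    qed
    show ?thesis using 6(1) by (simp add: split; simp add: ac_simps)
  qed (simp_all add: ac_simps flip: power_mult)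
  have "coeff_rel \<alpha> \<beta> \<delta> \<nu> 11 + coeff_rel \<alpha> \<beta> \<delta> \<nu> 13 + coeff_rel \<alpha> \<beta> \<delta> \<nu> 19 + coeff_rel \<alpha> \<beta> \<delta> \<nu> 21 =
      (\<Sum>i<n. \<alpha> ^ (2 ^ i) * (bit_sum \<nu> (11 + 2 ^ i) + bit_sum \<nu> (13 + 2 ^ i) +
         bit_sum \<nu> (19 + 2 ^ i) + bit_sum \<nu> (21 + 2 ^ i))) +
      (\<Sum>i<n. \<beta> ^ (2 ^ i) * (bit_sum \<nu> (?D 11 i) + bit_sum \<nu> (?D 13 i) +
         bit_sum \<nu> (?D 19 i) + bit_sum \<nu> (?D 21 i)))"
    by (simp only: coeff_rel_no_carry[OF assms] insert_iff simp_thms distrib_left sum.distrib ac_simps)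
  also have "\<dots> = (\<alpha> + \<beta>) ^ 4 * \<nu> ^ 16"
    unfolding a b using assms frob_add[of \<alpha> \<beta> 2] by (simp add: if_distrib distrib_right cong: if_cong)
  finally show ?thesis .
qed

text \<open>With \<open>\<nu>\<close> = 0 only the double sums remain, and 3 = 4 - 1 = 1 + 2 = 2 + 1
  accounts for the three monomials.\<close>

lemma coeff_rel_3_of_0:
  assumes "n \<ge> 5"
  shows "coeff_rel \<alpha> \<beta> \<delta> 0 3 = \<alpha> * \<delta> ^ 4 + \<beta> * \<delta> ^ 2 + \<beta> ^ 2 * \<delta>"
proof -
  have "(2 :: nat) ^ 4 \<le> 2 ^ (n - 1)" using assms by (intro power_increasing) auto
  hence small: "(2 :: nat) \<le> 3" "(3 :: nat) + 1 < 2 ^ (n - 1)" by auto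
  have 1: "3 + 2 ^ i = (2 :: nat) ^ j \<longleftrightarrow> i = 0 \<and> j = 2" for i j
    by (cases i rule: pow2_cases; cases j rule: pow2_cases; simp; presburger)
  have 2: "of_bool (3 = (2 :: nat) ^ i + 2 ^ j) =
      (of_bool (i = 0 \<and> j = 1) + of_bool (i = 1 \<and> j = 0) :: 'a)" for i j
    by (cases i rule: pow2_cases; cases j rule: pow2_cases; simp; presburger)
  have n: "0 < n" "1 < n" "2 < n" using assms by auto
  show ?thesis
    unfolding coeff_rel_small[OF small] 1 2 distrib_left sum.distrib
      sum_delta2[OF n(1,3)] sum_delta2[OF n(1,2)] sum_delta2[OF n(2,1)]
    by (simp add: add_ac power2_eq_square)
qed

text \<open>Here \<open>\<alpha> + \<beta>\<close> is p m, so the alternating relation gives (p m)^4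
  (m^2 + m)^16 = 0 and hence m = 1. Then \<open>\<nu>\<close> = 0 and the relation at 11 is zero, so
  the one at 3 reads p (1 + p)^5 = 0 and p = 1 = m.\<close>

lemma no_vanishing_product_6:
  assumes "n \<ge> 6" "p \<in> F" "m \<in> F" "p \<noteq> 0" "m \<noteq> 0" "p \<noteq> m"
    and zero: "\<And>x. x \<in> F \<Longrightarrow> x \<noteq> 0 \<Longrightarrow> x \<noteq> 1 \<Longrightarrow>
      T (p ^ 2 * x + (p ^ 2 + p * m) * inverse x) *
      T ((m ^ 2 + p * m) * inverse x + (m ^ 2 + m) * inverse (1 + x)) = 0"
  shows False
proof -
  have \<nu>: "T (m ^ 2 + m) = 0" by (simp add: T_add T_square[OF \<open>m \<in> F\<close>])
  let ?R = "coeff_rel (p ^ 2) (p ^ 2 + p * m) (m ^ 2 + p * m) (m ^ 2 + m)"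
  have const: "?R M = ?R M'" for M M'
    using coeff_rel_eq[OF zero \<nu>] by metis
  \<comment> \<open>Four equal terms cancel in characteristic 2.\<close>
  have "?R 11 + ?R 13 + ?R 19 + ?R 21 = 0"
    using const[of 13 11] const[of 19 11] const[of 21 11] by simp
  hence "(p * m) ^ 4 * (m ^ 2 + m) ^ 16 = 0"
    unfolding coeff_rel_alternating[OF assms(1)] by simp
  hence "m * (m + 1) = 0" using assms by (simp add: power2_eq_square distrib_left)
  hence m: "m = 1" using assms by (auto simp: add_eq_0_iff_eq)
  have "?R 3 = ?R 11" by (rule const)
  hence "p ^ 2 * (1 + p) ^ 4 + (p ^ 2 + p) * (1 + p) ^ 2 + (p ^ 2 + p) ^ 2 * (1 + p) = 0"
    using assms(1) by (simp add: m coeff_rel_3_of_0 coeff_rel_no_carry)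
  moreover have "p ^ 2 * (1 + p) ^ 4 + (p ^ 2 + p) * (1 + p) ^ 2 + (p ^ 2 + p) ^ 2 * (1 + p) =
      p * (1 + p) ^ 5"
    by (simp add: power_numeral_reduce algebra_simps)
  ultimately show False using assms m by (auto simp: add_eq_0_iff_eq)
qed

text \<open>
  The two quadruples of exponents come from a computer search for short combinations of the
  relations: the first one yields \<open>p = m ^ 19\<close>, the second one then \<open>m = 1\<close>.
\<close>
lemma no_vanishing_product_5:
  assumes n: "n = 5" and "p \<in> F" "m \<in> F" "p \<noteq> 0" "m \<noteq> 0" "p \<noteq> m"
    and zero: "\<And>x. x \<in> F \<Longrightarrow> x \<noteq> 0 \<Longrightarrow> x \<noteq> 1 \<Longrightarrow>
      T (p ^ 2 * x + (p ^ 2 + p * m) * inverse x) *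
      T ((m ^ 2 + p * m) * inverse x + (m ^ 2 + m) * inverse (1 + x)) = 0"
  shows False
proof -
  have \<nu>: "T (m ^ 2 + m) = 0" by (simp add: T_add T_square[OF \<open>m \<in> F\<close>])
  let ?R = "coeff_rel (p ^ 2) (p ^ 2 + p * m) (m ^ 2 + p * m) (m ^ 2 + m)"
  have const: "?R M = ?R M'" for M M'
    using coeff_rel_eq[OF zero \<nu>] by metis
  have N: "N = 31" unfolding N_def by (simp add: n)
  have n_set: "{..<n} = {0, 1, 2, 3, 4}" unfolding n by auto
  \<comment> \<open>The conjugates become atoms. The rules \<open>sq\<close> and \<open>sq'\<close>,
    cyclic because x^32 = x, then reduce every monomial to one without repeated atoms.\<close>
  define p1 p2 p3 p4 where "p1 = p ^ 2" and "p2 = p ^ 4" and "p3 = p ^ 8" and "p4 = p ^ 16"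
  define m1 m2 m3 m4 where "m1 = m ^ 2" and "m2 = m ^ 4" and "m3 = m ^ 8" and "m4 = m ^ 16"
  note defs = p1_def p2_def p3_def p4_def m1_def m2_def m3_def m4_def
  have p32: "p ^ 32 = p" and m32: "m ^ 32 = m"
    using frob_n[of p] frob_n[of m] assms by (simp_all add: n)
  have frob: "(x + y) ^ 2 = x ^ 2 + y ^ 2" "(x + y) ^ 4 = x ^ 4 + y ^ 4"
    "(x + y) ^ 8 = x ^ 8 + y ^ 8" "(x + y) ^ 16 = x ^ 16 + y ^ 16" for x y :: 'a
    using frob_add[of x y 1] frob_add[of x y 2] frob_add[of x y 3] frob_add[of x y 4] by simp_all
  have pow: "(x ^ 2) ^ 2 = x ^ 4" "(x ^ 2) ^ 4 = x ^ 8" "(x ^ 2) ^ 8 = x ^ 16"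
    "(x ^ 2) ^ 16 = x ^ 32" "(x ^ 4) ^ 2 = x ^ 8" "(x ^ 8) ^ 2 = x ^ 16"
    "(x ^ 16) ^ 2 = x ^ 32" for x :: 'a
    by (simp_all flip: power_mult)
  have sq: "p * p = p1" "p1 * p1 = p2" "p2 * p2 = p3" "p3 * p3 = p4" "p4 * p4 = p"
    "m * m = m1" "m1 * m1 = m2" "m2 * m2 = m3" "m3 * m3 = m4" "m4 * m4 = m"
    using p32 m32 by (simp_all add: defs flip: power_add power2_eq_square)
  have sq': "p * (p * z) = p1 * z" "p1 * (p1 * z) = p2 * z" "p2 * (p2 * z) = p3 * z"
    "p3 * (p3 * z) = p4 * z" "p4 * (p4 * z) = p * z"
    "m * (m * z) = m1 * z" "m1 * (m1 * z) = m2 * z" "m2 * (m2 * z) = m3 * z"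
    "m3 * (m3 * z) = m4 * z" "m4 * (m4 * z) = m * z" for z
    by (simp_all only: sq flip: mult.assoc)
  have bs2: "bit_sum v (Suc (Suc 0)) = v ^ 2" for v :: 'a
    unfolding numeral_2_eq_2[symmetric] by simp
  have p18: "p ^ 18 = p1 * p4" by (simp add: defs flip: power_add)
  note expand = bs2 coeff_rel_def n_set N frob pow power_mult_distrib p32 m32 distrib_left distrib_right
  have "0 = ?R 3 + ?R 5 + ?R 26 + ?R 28"
    using const[of 5 3] const[of 26 3] const[of 28 3] by simp
  also have "\<dots> = p2 * m2 * m4 + p * p2 * m"
    by (simp add: expand) (simp add: ac_simps sq sq' flip: defs)
  also have "\<dots> = p ^ 4 * m * (m ^ 19 + p)"
    by (simp add: defs algebra_simps flip: power_add power_Suc power_Suc2)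
  finally have p: "p = m ^ 19" using assms by (auto simp: add_eq_0_iff_eq)
  have "0 = ?R 1 + ?R 13 + ?R 17 + ?R 28"
    using const[of 13 1] const[of 17 1] const[of 28 1] by simp
  also have "\<dots> = p * m * m3 + p1 * m3 + p * p1 * m1 + p2 * m + p3 * m1 + p * p3 * m +
      p * p4 * m4 + p1 * p4 * m4"
    by (simp add: expand) (simp add: ac_simps sq sq' p18 flip: defs)
  also have "\<dots> = m ^ 29 * (m + 1)"
  proof -
    \<comment> \<open>After substituting p = m^19 only exponents modulo 31 matter, and six of the
      eight terms cancel in pairs.\<close>
    have red: "m ^ k = m ^ (k mod 31)" for k
      using power_mod_N[OF \<open>m \<in> F\<close> \<open>m \<noteq> 0\<close>, of k] by (simp add: N)
    have "p * m * m3 = m ^ (19 + 1 + 8)"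
      "p1 * m3 = m ^ (19 * 2 + 8)"
      "p * p1 * m1 = m ^ (19 + 19 * 2 + 2)"
      "p2 * m = m ^ (19 * 4 + 1)"
      "p3 * m1 = m ^ (19 * 8 + 2)"
      "p * p3 * m = m ^ (19 + 19 * 8 + 1)"
      "p * p4 * m4 = m ^ (19 + 19 * 16 + 16)"
      "p1 * p4 * m4 = m ^ (19 * 2 + 19 * 16 + 16)"
      by (simp_all only: defs p power_add power_mult power_one_right)
    hence "p * m * m3 = m ^ 28" "p1 * m3 = m ^ 15" "p * p1 * m1 = m ^ 28" "p2 * m = m ^ 15" "p3 * m1 = m ^ 30" "p * p3 * m = m ^ 17" "p * p4 * m4 = m ^ 29" "p1 * p4 * m4 = m ^ 17"
      by (simp_all only: red[of "_ + _"]) simp_all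
    moreover have "m ^ 30 = m ^ 29 * m" using power_add[of m 29 1] by simp
    ultimately show ?thesis by (simp add: add_ac distrib_left)
  qed
  finally have "m = 1" using assms by (auto simp: add_eq_0_iff_eq)
  thus False using p \<open>p \<noteq> m\<close> by simp
qed

end

section \<open>The case \<open>B = 0\<close>: combinations of \<open>2 ^ i\<close> and
  \<open>3 * 2 ^ j\<close> modulo \<open>N\<close>\<close>

lemma mod_cong_add: "a + m * b = c + m * d \<Longrightarrow> a mod m = c mod (m :: nat)"
  by (metis mod_mult_self2)

text \<open>This excludes wrapping once around \<open>N\<close>: if \<open>N + 1\<close> is 32 E,
  then 4 + N is 32 E + 3. For j \<ge> 3 residues modulo 32 decide, for smaller j the size of 2^i
  does.\<close>

lemma pow2_wrap_neq_1:
  assumes "2 * 2 ^ i \<le> 32 * (E :: nat)" "E \<ge> 1"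
  shows "2 ^ i + 3 * 2 ^ j \<noteq> 32 * E + (3 :: nat)"
proof
  assume eq: "2 ^ i + 3 * 2 ^ j = 32 * E + (3 :: nat)"
  show False
  proof (cases j rule: pow2_cases)
    case 4
    thus ?thesis using eq pow2_mod_32[of i] mod_cong_add[of "2 ^ i + 21" 32 0 0 E]
      mod_add_left_eq[of "2 ^ i" 32 "21 :: nat"] by auto
  next
    case 5
    thus ?thesis using eq pow2_mod_32[of i] mod_cong_add[of "2 ^ i + 45" 32 0 0 E]
      mod_add_left_eq[of "2 ^ i" 32 "45 :: nat"] by auto
  next
    case (6 c)
    thus ?thesis using eq pow2_mod_32[of i] mod_cong_add[of "2 ^ i" 32 "3 * (c + 1)" 3 E] by simp
  qed (use assms eq in auto)
qed

text \<open>The corresponding exclusion when 3 * 2^j is compared with 2^i + 4 + N.\<close>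

lemma pow2_wrap_neq_2:
  assumes "E \<ge> 1"
  shows "3 * 2 ^ j \<noteq> 2 ^ i + 32 * E + (3 :: nat)"
proof
  assume eq: "3 * 2 ^ j = 2 ^ i + 32 * E + (3 :: nat)"
  show False
  proof (cases j rule: pow2_cases)
    case 5
    thus ?thesis using eq pow2_mod_32[of i] mod_cong_add[of "2 ^ i" 32 E 45 0] by auto
  next
    case (6 c)
    thus ?thesis using eq pow2_mod_32[of i] mod_cong_add[of "2 ^ i + 3" 32 E 0 "3 * (c + 1)"]
      mod_add_left_eq[of "2 ^ i" 32 "3 :: nat"] by auto
  qed (use assms eq in auto)
qed

lemma pow2_add_triple_eq_4: "2 ^ i + 3 * 2 ^ j = (4 :: nat) \<Longrightarrow> i = 0 \<and> j = 0"
proof -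
  assume "2 ^ i + 3 * 2 ^ j = (4 :: nat)"
  moreover have "(2 :: nat) ^ i \<ge> 1" "(2 :: nat) ^ j \<ge> 1" by simp_all
  ultimately have "(2 :: nat) ^ i = 1" "(2 :: nat) ^ j = 1" by linarith+
  thus ?thesis by simp
qed

lemma pow2_add_eq_4: "2 ^ i + 2 ^ j = (4 :: nat) \<Longrightarrow> i = 1 \<and> j = 1"
proof -
  assume eq: "2 ^ i + 2 ^ j = (4 :: nat)"
  moreover have "(2 :: nat) ^ i > 0" "(2 :: nat) ^ j > 0" by simp_all
  ultimately have "(2 :: nat) ^ i < 4" "(2 :: nat) ^ j < 4" by linarith+
  hence "(2 :: nat) ^ i < 2 ^ 2" "(2 :: nat) ^ j < 2 ^ 2" by simp_all
  hence "i < 2" "j < 2" by (simp_all only: power_strict_increasing_iff one_less_numeral_iff semiring_norm)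
  hence "i = 0 \<or> i = 1" "j = 0 \<or> j = 1" by linarith+
  thus ?thesis using eq by auto
qed

lemma pow2_triple_eq_add_4: "3 * 2 ^ j = 2 ^ i + (4 :: nat) \<Longrightarrow> i = 1 \<and> j = 1 \<or> i = 3 \<and> j = 2"
proof -
  assume eq: "3 * 2 ^ j = 2 ^ i + (4 :: nat)"
  have i: "2 ^ i = (2 :: nat) \<Longrightarrow> i = 1" "2 ^ i = (8 :: nat) \<Longrightarrow> i = 3"
    using power_inject_exp[of "2 :: nat" i 1] power_inject_exp[of "2 :: nat" i 3] by simp_all
  show ?thesis
  proof (cases j rule: pow2_cases)
    case 4
    hence "(2 :: nat) ^ i = 20" using eq by simp
    thus ?thesis using pow2_mod_32[of i] by simp
  next
    case 5
    hence "(2 :: nat) ^ i = 44" using eq by simp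
    thus ?thesis using pow2_mod_32[of i] by simp
  next
    case (6 c)
    thus ?thesis using eq pow2_mod_32[of i] mod_cong_add[of "2 ^ i + 4" 32 0 0 "3 * (c + 1)"]
      mod_add_left_eq[of "2 ^ i" 32 "4 :: nat"] by auto
  qed (use i eq in auto)
qed

lemma pow2_eq_add_4: "2 ^ j = 2 ^ i + (4 :: nat) \<Longrightarrow> i = 2 \<and> j = 3"
proof -
  assume eq: "2 ^ j = 2 ^ i + (4 :: nat)"
  have j: "2 ^ j = (8 :: nat) \<Longrightarrow> j = 3"
    using power_inject_exp[of "2 :: nat" j 3] by simp_all
  have "(2 :: nat) ^ j mod 32 = (2 ^ i mod 32 + 4) mod 32" unfolding eq by (simp add: mod_add_left_eq)
  moreover have "(2 :: nat) ^ j mod 32 \<noteq> 4"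
  proof
    assume "(2 :: nat) ^ j mod 32 = 4"
    hence "j = 2" by (cases j rule: pow2_cases) simp_all
    thus False using eq by simp
  qed
  ultimately have "(2 :: nat) ^ i mod 32 = 4" using pow2_mod_32[of i] pow2_mod_32[of j] by auto
  hence "i = 2" by (cases i rule: pow2_cases) simp_all
  thus ?thesis using eq j by simp
qed

lemma mod_eq_cases:
  fixes k l N :: nat
  assumes "k mod N = l mod N" "k < l + 3 * N" "l < k + N"
  shows "k = l \<or> k = l + N \<or> k = l + 2 * N"
proof (cases "l \<le> k")
  case True
  then obtain t where t: "k = l + N * t"
    using assms(1) by (metis mod_eq_dvd_iff_nat dvdE le_add_diff_inverse)
  hence "N * t < N * 3" using assms(2) by simp
  hence "t < 3" by simp
  hence "t = 0 \<or> t = 1 \<or> t = 2" by linarith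
  thus ?thesis using t by auto
next
  case False
  hence "N dvd l - k" using assms(1) by (metis mod_eq_dvd_iff_nat nat_le_linear)
  moreover have "0 < l - k" "l - k < N" using False assms(3) by auto
  ultimately show ?thesis by (auto dest: dvd_imp_le)
qed

context char2_subfield
begin

text \<open>Divide by v^4 and sum over v. The index pair (1,1) arises twice and cancels; (3,2) and
  (2,3) carry the same coefficient and cancel too. Only (0,0) survives, leaving c^2 = 0.\<close>

lemma no_vanishing_product_cubic:
  assumes n: "n \<ge> 5" and "c \<noteq> 0"
    and zero: "\<And>v. v \<in> F \<Longrightarrow> v \<noteq> 0 \<Longrightarrow> v \<noteq> 1 \<Longrightarrow>
      T (c * v + c * inverse v) * T (c * v ^ 3 + c * v) = 0"
  shows False
proof -
  obtain e where e: "(2 :: nat) ^ n = 32 * (e + 1)"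
    using n by (cases n rule: pow2_cases) auto
  define E where "E = e + 1"
  have pow: "(2 :: nat) ^ n = 32 * E" and E: "E \<ge> 1" using e by (simp_all add: E_def)
  have N: "N + 1 = 32 * E" using pow pow_n by simp
  have half: "2 * (2 :: nat) ^ i \<le> 32 * E" if "i < n" for i
  proof -
    have "(2 :: nat) ^ Suc i \<le> 2 ^ n" using that by (intro power_increasing) auto
    thus ?thesis using pow by simp
  qed
  have b1: "(2 ^ i + 3 * 2 ^ j) mod N = 4 mod N \<longleftrightarrow> i = 0 \<and> j = 0" if "i < n" "j < n" for i j
  proof
    assume *: "(2 ^ i + 3 * 2 ^ j) mod N = 4 mod N"
    have "2 ^ i + 3 * 2 ^ j = (4 :: nat) \<or> 2 ^ i + 3 * 2 ^ j = 4 + N \<or> 2 ^ i + 3 * 2 ^ j = 4 + 2 * N"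
      using half[OF that(1)] half[OF that(2)] N E by (intro mod_eq_cases[OF *]) linarith+
    thus "i = 0 \<and> j = 0"
      using pow2_add_triple_eq_4[of i j] pow2_wrap_neq_1[of i E j] half[OF that(1)] half[OF that(2)] N E
      by (elim disjE) linarith+
  qed auto
  have b2: "(2 ^ i + 2 ^ j) mod N = 4 mod N \<longleftrightarrow> i = 1 \<and> j = 1" if "i < n" "j < n" for i j
  proof
    assume *: "(2 ^ i + 2 ^ j) mod N = 4 mod N"
    have "2 ^ i + 2 ^ j = (4 :: nat) \<or> 2 ^ i + 2 ^ j = 4 + N \<or> 2 ^ i + 2 ^ j = 4 + 2 * N"
      using half[OF that(1)] half[OF that(2)] N E by (intro mod_eq_cases[OF *]) linarith+
    thus "i = 1 \<and> j = 1"
      using pow2_add_eq_4[of i j] half[OF that(1)] half[OF that(2)] N by (elim disjE) linarith+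
  qed auto
  have b3: "(3 * 2 ^ j) mod N = (2 ^ i + 4) mod N \<longleftrightarrow> i = 1 \<and> j = 1 \<or> i = 3 \<and> j = 2"
    if "i < n" "j < n" for i j
  proof
    assume *: "(3 * 2 ^ j) mod N = (2 ^ i + 4) mod N"
    have "3 * 2 ^ j = (2 ^ i + 4 :: nat) \<or> 3 * 2 ^ j = 2 ^ i + 4 + N \<or> 3 * 2 ^ j = 2 ^ i + 4 + 2 * N"
      using half[OF that(1)] half[OF that(2)] N E by (intro mod_eq_cases[OF *]) linarith+
    thus "i = 1 \<and> j = 1 \<or> i = 3 \<and> j = 2"
      using pow2_triple_eq_add_4[of j i] pow2_wrap_neq_2[of E j i] half[OF that(2)] N E
      by (elim disjE) linarith+
  qed auto
  have b4: "(2 ^ j) mod N = (2 ^ i + 4) mod N \<longleftrightarrow> i = 2 \<and> j = 3" if "i < n" "j < n" for i j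
  proof
    assume *: "(2 ^ j) mod N = (2 ^ i + 4) mod N"
    have "2 ^ j = (2 ^ i + 4 :: nat) \<or> 2 ^ j = 2 ^ i + 4 + N \<or> 2 ^ j = 2 ^ i + 4 + 2 * N"
      using half[OF that(1)] half[OF that(2)] N E by (intro mod_eq_cases[OF *]) linarith+
    thus "i = 2 \<and> j = 3"
      using pow2_eq_add_4[of j i] half[OF that(2)] N by (elim disjE) linarith+
  qed auto
  let ?g = "\<lambda>i j. c ^ (2 ^ i) * c ^ (2 ^ j)"
  have "0 = (\<Sum>v\<in>F-{0,1}. T (c * v + c * inverse v) * T (c * v ^ 3 + c * v) * inverse v ^ 4)"
    using zero by (intro sum.neutral[symmetric]) auto
  also have "\<dots> = (\<Sum>v\<in>F-{0,1}. \<Sum>i<n. \<Sum>j<n. ?g i j *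
      (v ^ (2 ^ i + 3 * 2 ^ j) * inverse v ^ 4 + v ^ (2 ^ i + 2 ^ j) * inverse v ^ 4 +
       v ^ (3 * 2 ^ j) * inverse v ^ (2 ^ i + 4) + v ^ (2 ^ j) * inverse v ^ (2 ^ i + 4)))"
  proof (intro sum.cong refl)
    fix v :: 'a
    have t1: "T (c * v + c * inverse v) =
        (\<Sum>i<n. c ^ (2 ^ i) * v ^ (2 ^ i) + c ^ (2 ^ i) * inverse v ^ (2 ^ i))"
      by (simp add: T_def frob_add power_mult_distrib)
    have t2: "T (c * v ^ 3 + c * v) =
        (\<Sum>j<n. c ^ (2 ^ j) * v ^ (3 * 2 ^ j) + c ^ (2 ^ j) * v ^ (2 ^ j))"
      by (simp add: T_def frob_add power_mult_distrib power_mult)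
    show "T (c * v + c * inverse v) * T (c * v ^ 3 + c * v) * inverse v ^ 4 =
      (\<Sum>i<n. \<Sum>j<n. ?g i j *
      (v ^ (2 ^ i + 3 * 2 ^ j) * inverse v ^ 4 + v ^ (2 ^ i + 2 ^ j) * inverse v ^ 4 +
       v ^ (3 * 2 ^ j) * inverse v ^ (2 ^ i + 4) + v ^ (2 ^ j) * inverse v ^ (2 ^ i + 4)))"
      unfolding t1 t2 unfolding sum_product unfolding sum_distrib_right
      by (intro sum.cong refl) (simp only: power_add distrib_left distrib_right ac_simps)
  qed
  also have "\<dots> = (\<Sum>i<n. \<Sum>j<n. ?g i j *
      (of_bool (\<not> (i = 0 \<and> j = 0)) + of_bool (\<not> (i = 1 \<and> j = 1)) +
       of_bool (\<not> (i = 1 \<and> j = 1 \<or> i = 3 \<and> j = 2)) + of_bool (\<not> (i = 2 \<and> j = 3))))"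
  proof (rule trans[OF sum.swap], rule sum.cong[OF refl], rule trans[OF sum.swap],
      rule sum.cong[OF refl], goal_cases)
    case (1 i j)
    thus ?case
      by (simp only: sum_distrib_left[symmetric] sum.distrib laurent_sum lessThan_iff b1 b2 b3 b4)
  qed
  also have "\<dots> = (\<Sum>i<n. \<Sum>j<n. ?g i j * of_bool (i = 0 \<and> j = 0) +
      ?g i j * of_bool (i = 3 \<and> j = 2) + ?g i j * of_bool (i = 2 \<and> j = 3))"
  proof (intro sum.cong refl)
    fix i j :: nat
    have "of_bool (\<not> (i = 0 \<and> j = 0)) + of_bool (\<not> (i = 1 \<and> j = 1)) +
       of_bool (\<not> (i = 1 \<and> j = 1 \<or> i = 3 \<and> j = 2)) + of_bool (\<not> (i = 2 \<and> j = 3)) =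
       (of_bool (i = 0 \<and> j = 0) + of_bool (i = 3 \<and> j = 2) + of_bool (i = 2 \<and> j = 3) :: 'a)"
      by (auto simp: char2)
    thus "?g i j * (of_bool (\<not> (i = 0 \<and> j = 0)) + of_bool (\<not> (i = 1 \<and> j = 1)) +
       of_bool (\<not> (i = 1 \<and> j = 1 \<or> i = 3 \<and> j = 2)) + of_bool (\<not> (i = 2 \<and> j = 3))) =
       ?g i j * of_bool (i = 0 \<and> j = 0) + ?g i j * of_bool (i = 3 \<and> j = 2) +
       ?g i j * of_bool (i = 2 \<and> j = 3)"
      by (simp only: distrib_left)
  qed
  also have "\<dots> = ?g 0 0 + ?g 3 2 + ?g 2 3"
    unfolding sum.distrib using n
    by (intro arg_cong2[of _ _ _ _ plus] sum_delta2) auto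
  also have "\<dots> = c ^ 2" by (simp add: power2_eq_square flip: power_add)
  finally show False using \<open>c \<noteq> 0\<close> by simp
qed

subsection \<open>Collisions of the rational function\<close>

text \<open>With u = x^2 + x + d, a collision of x and x + s means u (u + s^2 + s) (A s + B) = s +
  1. Putting u = (s^2 + s) w turns this into w^2 + w = h / s^2. If both traces were 1, then h / s^2
  would have trace 0 and w would exist; moreover u and d would both have trace 1, so x would exist
  as well.\<close>

lemma inj_imp_trace_product_eq_0:
  assumes F: "A \<in> F" "B \<in> F" "d \<in> F"
    and no_root: "\<And>x. x \<in> F \<Longrightarrow> x ^ 2 + x + d \<noteq> 0"
    and inj: "inj_on (\<lambda>x. A * x ^ 2 + B * x + inverse (x ^ 2 + x + d)) F"
    and s: "s \<in> F" "s \<noteq> 0" "s \<noteq> 1" "A * s + B \<noteq> 0"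
  defines "h \<equiv> inverse ((A * s + B) * (s + 1))"
  shows "T h * T (h * inverse s ^ 2 + h) = 0"
proof (rule ccontr)
  assume nz: "T h * T (h * inverse s ^ 2 + h) \<noteq> 0"
  have hF: "h \<in> F" using F s by (auto simp: h_def)
  hence "T h = 1" "T (h * inverse s ^ 2 + h) = 1"
    using nz T_cases[of h] T_cases[of "h * inverse s ^ 2 + h"] s by auto
  hence h0: "T (h * inverse s ^ 2) = 0" by (simp add: T_add)
  have gen: "Y ^ 2 * inverse (X * Y) * X = Y" if "X \<noteq> 0" "Y \<noteq> 0" for X Y :: 'a
    using that by (simp add: power2_eq_square field_simps)
  have s1: "s + 1 \<noteq> 0" using s by (auto simp: add_eq_0_iff_eq)
  obtain w where w: "w \<in> F" "w ^ 2 + w = h * inverse s ^ 2"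
    using T_eq_0_imp[OF _ h0] hF s by auto
  define u where "u = (s ^ 2 + s) * w"
  have uF: "u \<in> F" using w s by (auto simp: u_def)
  \<comment> \<open>Replacing s w by its square preserves the trace and produces the combination w^2
    + w.\<close>
  have "T u = T (s ^ 2 * w) + T ((s * w) ^ 2)"
    using T_square[of "s * w"] w s by (simp add: u_def distrib_right T_add)
  also have "\<dots> = T (s ^ 2 * (w ^ 2 + w))"
    by (simp add: T_add[symmetric] power_mult_distrib distrib_left add.commute)
  also have w': "s ^ 2 * (w ^ 2 + w) = h"
    unfolding w(2) using s by (simp add: power_inverse)
  finally have Tu: "T u = 1" using \<open>T h = 1\<close> by simp
  have "T d = 1"
  proof (rule ccontr)
    assume "T d \<noteq> 1"
    hence "T d = 0" using T_cases F by blast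
    then obtain x where "x \<in> F" "x ^ 2 + x = d" using T_eq_0_imp[of d] F by blast
    thus False using no_root[of x] by simp
  qed
  hence "T (u + d) = 0" using Tu by (simp add: T_add)
  then obtain x where x: "x \<in> F" "x ^ 2 + x = u + d"
    using T_eq_0_imp[of "u + d"] uF F by blast
  have Px: "x ^ 2 + x + d = u" using x by (simp add: add.assoc)
  have Py: "(x + s) ^ 2 + (x + s) + d = u + (s ^ 2 + s)"
    using Px by (simp add: power2_add ac_simps)
  have nz: "u \<noteq> 0" "u + (s ^ 2 + s) \<noteq> 0"
    using no_root[of x] no_root[of "x + s"] x s Px Py by auto
  have "u * (u + (s ^ 2 + s)) = (s ^ 2 + s) ^ 2 * (w ^ 2 + w)"
    unfolding u_def by (simp add: power2_eq_square algebra_simps)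
  also have "(s ^ 2 + s) ^ 2 = s ^ 2 * (s + 1) ^ 2"
    by (simp add: power2_eq_square algebra_simps)
  also have "s ^ 2 * (s + 1) ^ 2 * (w ^ 2 + w) = (s + 1) ^ 2 * h"
    unfolding w'[symmetric] by (simp only: ac_simps)
  also have "\<dots> * (A * s + B) = s + 1"
    using gen[OF s(4) s1] by (simp add: h_def)
  finally have prod: "u * (u + (s ^ 2 + s)) * (A * s + B) = s + 1" by simp
  have "inverse u + inverse (u + (s ^ 2 + s)) = (s ^ 2 + s) * inverse (u * (u + (s ^ 2 + s)))"
    using nz by (simp add: field_simps)
  also have "inverse (u * (u + (s ^ 2 + s))) = (A * s + B) * inverse (s + 1)"
    using inverse_unique[of "u * (u + (s ^ 2 + s))" "(A * s + B) * inverse (s + 1)"] prod s1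
    by (simp flip: mult.assoc)
  also have "(s ^ 2 + s) * ((A * s + B) * inverse (s + 1)) = s * (A * s + B) * ((s + 1) * inverse (s + 1))"
    by (simp add: power2_eq_square algebra_simps)
  also have "\<dots> = A * s ^ 2 + B * s"
    unfolding right_inverse[OF s1] by (simp add: power2_eq_square algebra_simps)
  finally have key: "inverse u + inverse (u + (s ^ 2 + s)) = A * s ^ 2 + B * s" .
  have "A * (x + s) ^ 2 + B * (x + s) + inverse (u + (s ^ 2 + s)) =
      A * x ^ 2 + B * x + (A * s ^ 2 + B * s) + inverse (u + (s ^ 2 + s))"
    by (simp add: power2_add algebra_simps)
  also have "\<dots> = A * x ^ 2 + B * x + inverse u"
    unfolding key[symmetric] by (simp add: ac_simps)
  finally have "x + s = x"
    using inj_onD[OF inj, of "x + s" x] x s unfolding Px Py by auto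
  thus False using s by simp
qed

lemma not_inj_on_quartic:
  assumes n: "n \<ge> 5" and F: "A \<in> F" "t \<in> F" "d \<in> F" and A: "A \<noteq> 0"
    and B: "B = 0 \<or> B = t ^ 2 \<and> t \<noteq> 0"
    and no_root: "\<And>x. x \<in> F \<Longrightarrow> x ^ 2 + x + d \<noteq> 0"
  shows "\<not> inj_on (\<lambda>x. A * x ^ 2 + B * x + inverse (x ^ 2 + x + d)) F"
proof
  assume inj: "inj_on (\<lambda>x. A * x ^ 2 + B * x + inverse (x ^ 2 + x + d)) F"
  have BF: "B \<in> F" using B F by auto
  define D where "D = A + B"
  \<comment> \<open>If A = B, the points 0 and 1 collide, since x^2 + x vanishes at both.\<close>
  have D: "D \<noteq> 0"
  proof
    assume "D = 0"
    hence "A = B" by (simp add: D_def add_eq_0_iff_eq)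
    thus False using inj_onD[OF inj, of 0 1] by (simp add: char2)
  qed
  note prod_eq_0 = inj_imp_trace_product_eq_0[OF \<open>A \<in> F\<close> BF \<open>d \<in> F\<close> no_root inj]
  show False
  proof (cases "B = 0")
    case True
    show False
    proof (rule no_vanishing_product_cubic[OF n])
      show "inverse A \<noteq> 0" using A by simp
      fix v assume v: "v \<in> F" "v \<noteq> 0" "v \<noteq> 1"
      \<comment> \<open>For this s one has 1/s^2 + 1 = v^2, so the second trace argument is h
        v^2.\<close>
      define s where "s = inverse (1 + v)"
      have v1: "1 + v \<noteq> 0" using v by (auto simp: add_eq_0_iff_eq)
      have s1: "s + 1 = v * s" using v1 by (simp add: s_def field_simps)
      have s: "s \<in> F" "s \<noteq> 0" "s \<noteq> 1" "A * s + B \<noteq> 0"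
        using v v1 A s1 True by (auto simp: s_def)
      define h where "h = inverse ((A * s + B) * (s + 1))"
      have "h = inverse A * (1 + v) ^ 2 * inverse v"
        by (simp add: h_def s1 True) (simp add: s_def power2_eq_square)
      also have "(1 + v) ^ 2 = 1 + v ^ 2" by (simp add: power2_add)
      also have "inverse A * (1 + v ^ 2) * inverse v = inverse A * v + inverse A * inverse v"
        using v by (simp add: power2_eq_square algebra_simps)
      finally have h: "h = inverse A * v + inverse A * inverse v" .
      have "h * inverse s ^ 2 + h = h * v ^ 2"
        by (simp add: s_def power2_add distrib_left)
      also have "\<dots> = inverse A * v ^ 3 + inverse A * v"
        using v by (simp add: h power2_eq_square power3_eq_cube algebra_simps)
      finally have h': "h * inverse s ^ 2 + h = inverse A * v ^ 3 + inverse A * v" .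
      show "T (inverse A * v + inverse A * inverse v) * T (inverse A * v ^ 3 + inverse A * v) = 0"
        using prod_eq_0[OF _ s] unfolding h_def[symmetric] h' unfolding h by blast
    qed
  next
    case False
    hence t: "t \<noteq> 0" "B = t ^ 2" using B by auto
    have A_eq: "A = D + t ^ 2" by (simp add: D_def t add.assoc)
    \<comment> \<open>These parameters satisfy p m = 1 / t^2, and p = m would mean D = t^2, that is
      A = 0.\<close>
    define p where "p = t * inverse D"
    define m where "m = D * inverse (t ^ 3)"
    have pm: "p \<in> F" "m \<in> F" "p \<noteq> 0" "m \<noteq> 0"
      using F BF D t by (auto simp: p_def m_def D_def)
    have "p \<noteq> m"
    proof
      assume "p = m"
      hence "t * t ^ 3 = D * D" using D t by (simp add: p_def m_def field_simps)
      hence "(D + t ^ 2) ^ 2 = 0"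
        unfolding power2_add by (simp add: power2_eq_square power3_eq_cube mult.assoc)
      thus False using A A_eq by simp
    qed
    have zero: "T (p ^ 2 * x + (p ^ 2 + p * m) * inverse x) *
        T ((m ^ 2 + p * m) * inverse x + (m ^ 2 + m) * inverse (1 + x)) = 0"
      if x: "x \<in> F" "x \<noteq> 0" "x \<noteq> 1" for x
    proof -
      define C where "C = D + t ^ 2 * (1 + x)"
      have x1: "1 + x \<noteq> 0" using x by (auto simp: add_eq_0_iff_eq)
      have C2: "C ^ 2 = D ^ 2 + t ^ 4 + t ^ 4 * x ^ 2"
        by (simp add: C_def power2_add power_mult_distrib distrib_left add.assoc flip: power_mult)
      have h: "p ^ 2 * x + (p ^ 2 + p * m) * inverse x = C ^ 2 * inverse (t ^ 2 * D ^ 2 * x)"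
        unfolding C2 p_def m_def using D t(1) x
        by (simp add: field_simps power2_eq_square power3_eq_cube power4_eq_xxxx)
      \<comment> \<open>Partial fractions with a simple pole at 0 and a double pole at 1. The double
        pole term is a square, so under the trace it becomes a simple pole, whence the coefficient
        m^2 + m.\<close>
      have g: "(m ^ 2 + p * m) * inverse x + m ^ 2 * inverse (1 + x) + (m * inverse (1 + x)) ^ 2 =
          C ^ 2 * inverse (t ^ 6 * x * (1 + x) ^ 2)"
      proof -
        have C: "C ^ 2 * inverse (t ^ 6) = m ^ 2 + p * m + p * m * x ^ 2"
          unfolding C2 p_def m_def using D t(1)
          by (simp add: field_simps power_numeral_reduce)
        have "(J + K) * inverse x + J * inverse (1 + x) + J * inverse (1 + x) ^ 2 =
            (J + K + K * x ^ 2) * inverse (x * (1 + x) ^ 2)" for J K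
        proof -
          have "((J + K) * inverse x + J * inverse y + J * inverse y ^ 2) * (x * y ^ 2) =
              (J + K) * y ^ 2 + J * x * y + J * x" if "y \<noteq> 0" for y
            using that x by (simp add: field_simps power2_eq_square)
          from this[OF x1]
          have "((J + K) * inverse x + J * inverse (1 + x) + J * inverse (1 + x) ^ 2) * (x * (1 + x) ^ 2)
              = (J + K) * (1 + x) ^ 2 + J * x * (1 + x) + J * x" .
          also have "\<dots> = J + K + K * x ^ 2"
            by (simp add: power2_eq_square algebra_simps)
          finally show ?thesis using x x1 by (simp add: field_simps)
        qed
        from this[of "m ^ 2" "p * m"] show ?thesis
          unfolding C[symmetric] by (simp add: power_mult_distrib mult.assoc)
      qed
      have "T (m ^ 2 * inverse (1 + x) + (m * inverse (1 + x)) ^ 2) = T ((m ^ 2 + m) * inverse (1 + x))"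
        using x pm by (simp add: T_add T_square distrib_right)
      hence Tg: "T ((m ^ 2 + p * m) * inverse x + (m ^ 2 + m) * inverse (1 + x)) =
          T (C ^ 2 * inverse (t ^ 6 * x * (1 + x) ^ 2))"
        unfolding g[symmetric] by (simp add: T_add add.assoc)
      show ?thesis
      \<comment> \<open>At C = 0 the parameter s would be infinite, but there the argument of the
        first trace is 0.\<close>
      proof (cases "C = 0")
        case True
        thus ?thesis unfolding h by simp
      next
        case False
        \<comment> \<open>This Moebius map sends x = 1, 0, \<infinity> to s = 0, B/A, 1, the
          excluded values of s.\<close>
        define s where "s = t ^ 2 * (1 + x) * inverse C"
        have s1: "s + 1 = D * inverse C"
          using False by (simp add: s_def C_def field_simps)
        have AsB: "A * s + B = t ^ 2 * D * x * inverse C"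
          using False unfolding A_eq t(2) s_def by (simp add: C_def field_simps)
        have s: "s \<in> F" "s \<noteq> 0" "s \<noteq> 1" "A * s + B \<noteq> 0"
        proof -
          show "s \<in> F" using F BF x by (auto simp: s_def C_def D_def)
          show "s \<noteq> 0" using t x1 False by (simp add: s_def)
          have "s + 1 \<noteq> 0" using D False by (simp add: s1)
          thus "s \<noteq> 1" by auto
          show "A * s + B \<noteq> 0" unfolding AsB using t D x False by simp
        qed
        define h where "h = inverse ((A * s + B) * (s + 1))"
        have h1: "h = C ^ 2 * inverse (t ^ 2 * D ^ 2 * x)"
          unfolding h_def AsB s1 using False by (simp add: power2_eq_square)
        have "h * inverse s ^ 2 + h = h * inverse s ^ 2 * (s + 1) ^ 2"
          using s(2) by (simp add: power2_add distrib_left power_inverse)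
        also have "\<dots> = C ^ 2 * inverse (t ^ 6 * x * (1 + x) ^ 2)"
        proof -
          have "c ^ 2 * inverse (t ^ 2 * e ^ 2 * x) * inverse (t ^ 2 * y * inverse c) ^ 2 *
              (e * inverse c) ^ 2 = c ^ 2 * inverse (t ^ 6 * x * y ^ 2)"
            if "c \<noteq> 0" "e \<noteq> 0" "y \<noteq> 0" for c e y
            using that t(1) x(2) by (simp add: field_simps power_numeral_reduce)
          from this[OF False D x1] show ?thesis unfolding s1 unfolding h1 s_def .
        qed
        finally have h2: "h * inverse s ^ 2 + h = C ^ 2 * inverse (t ^ 6 * x * (1 + x) ^ 2)" .
        show ?thesis unfolding Tg h
          using prod_eq_0[OF _ s] unfolding h_def[symmetric] h2 unfolding h1 by blast
      qed
    qed
    show False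
    proof (cases "n = 5")
      case True
      show False by (rule no_vanishing_product_5[OF True pm \<open>p \<noteq> m\<close> zero])
    next
      case False
      hence "n \<ge> 6" using n by simp
      thus False by (rule no_vanishing_product_6[OF _ pm \<open>p \<noteq> m\<close> zero])
    qed
  qed
qed

end

section \<open>From permutations of the projective line to the normalised map on
  \<open>F\<close>\<close>

lemma is_subfield_UNIV: "is_subfield UNIV"
  by (simp add: is_subfield_def)

text \<open>Translation by 1 permutes the field, so the sum of all elements is unchanged although it
  gains the cardinality times 1; hence 2^k = 0.\<close>

lemma char_2_if_card:
  assumes "CARD('k :: {field, finite}) = 2 ^ k"
  shows "(1 :: 'k) + 1 = 0"
proof -
  have "(\<Sum>x\<in>UNIV. x) = (\<Sum>x\<in>UNIV. x + (1 :: 'k))"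
    by (rule sum.reindex_bij_witness[of _ "\<lambda>x. x + 1" "\<lambda>x. x - 1"]) auto
  also have "\<dots> = (\<Sum>x\<in>UNIV. x) + of_nat (CARD('k))" by (simp add: sum.distrib)
  finally have "of_nat (2 ^ k) = (0 :: 'k)" by (simp add: assms)
  hence "(2 :: 'k) ^ k = 0" by simp
  thus ?thesis by simp
qed

theorem theorem4p1:
  fixes F :: "'k :: {field, finite} set" and n q :: nat and a b r :: 'k
    and f :: "'k poly fract"
  assumes "n \<ge> 5" and "q = 2 ^ n"
    and "CARD('k) = q\<^sup>2" and "is_subfield F" and "card F = q"
    and "a \<in> F" and "a \<noteq> 0" and "b \<in> {0, 1}" and "r \<notin> F"
    and "f = rat_const a * rat_X\<^sup>2 + rat_const b * rat_X
             + 1 / (rat_X - rat_const r) + 1 / (rat_X - rat_const (r ^ q))"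
  shows "\<not> perm_rat_fun F f"
proof
  assume perm: "perm_rat_fun F f"
  have card: "CARD('k) = 2 ^ (2 * n)"
    using assms(2,3) by (simp add: mult.commute flip: power_mult)
  interpret char2_subfield F n
    using assms char_2_if_card[OF card] by unfold_locales auto
  \<comment> \<open>Applied to the whole field, \<open>U.frob_n\<close> gives r^(q^2) = r, so
    conjugation is an involution.\<close>
  interpret U: char2_subfield "UNIV :: 'k set" "2 * n"
    using assms(1) card char_2_if_card[OF card] is_subfield_UNIV by unfold_locales auto
  define r' where "r' = r ^ q"
  have r': "r' ^ q = r"
    using U.frob_n[of r] by (simp add: r'_def assms(2) mult_2 power_add power_mult)
  have "r' \<noteq> r" using \<open>r \<notin> F\<close> mem_F_iff[of r] by (auto simp: r'_def assms(2))
  have "r' \<notin> F"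
    using \<open>r' \<noteq> r\<close> r' mem_F_iff[of r'] by (auto simp: assms(2))
  define t where "t = r + r'"
  have t: "t \<noteq> 0" using \<open>r' \<noteq> r\<close> by (auto simp: t_def add_eq_0_iff_eq)
  have tF: "t \<in> F" unfolding mem_F_iff
    using r' by (simp add: t_def frob_add assms(2) r'_def add.commute)
  have nF: "r * r' \<in> F" unfolding mem_F_iff
    using r' by (simp add: power_mult_distrib assms(2) r'_def mult.commute)
  \<comment> \<open>In characteristic 2 the two simple fractions add up to t / Q. Thus P is
    congruent to the unit t modulo Q, which gives coprimality.\<close>
  define Q where "Q = [:- r, 1:] * [:- r', 1:]"
  define P where "P = [:0, b, a:] * Q + [:t:]"
  have Q0: "Q \<noteq> 0" by (simp add: Q_def)
  have cop: "coprime P Q"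
  proof (rule coprimeI)
    fix c assume "c dvd P" "c dvd Q"
    hence "c dvd [:t:]" unfolding P_def by (metis dvd_add_right_iff dvd_mult)
    moreover have "is_unit [:t:]" using t by (simp add: is_unit_pCons_iff)
    ultimately show "is_unit c" by (rule dvd_unit_imp_unit)
  qed
  have "f = Fract P Q"
  proof -
    have 1: "rat_X - rat_const c = to_fract [:- c, 1:]" for c :: 'k
      by (simp add: rat_X_def rat_const_def flip: to_fract_diff)
    have 2: "rat_const a * rat_X ^ 2 + rat_const b * rat_X = to_fract [:0, b, a:]"
      by (simp add: rat_X_def rat_const_def power2_eq_square flip: to_fract_mult to_fract_add)
    have 3: "to_fract [:- r, 1:] + to_fract [:- r', 1:] = to_fract [:t:]"
      by (simp add: t_def flip: to_fract_add)
    have nz: "to_fract [:- c, 1:] \<noteq> 0" for c :: 'k by simp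
    have "f = to_fract [:0, b, a:] + (1 / to_fract [:- r, 1:] + 1 / to_fract [:- r', 1:])"
      unfolding assms(10) 1 2 r'_def by (simp add: add.assoc)
    also have "1 / to_fract [:- r, 1:] + 1 / to_fract [:- r', 1:] = to_fract [:t:] / to_fract Q"
      unfolding 3[symmetric] Q_def to_fract_mult using nz by (simp add: field_simps)
    also have "to_fract [:0, b, a:] + \<dots> = to_fract P / to_fract Q"
      unfolding P_def to_fract_add to_fract_mult using Q0 by (simp add: add_divide_distrib)
    finally show ?thesis by (simp add: Fract_conv_to_fract)
  qed
  hence map: "rat_map f = quot_map P Q" using rat_map_Fract[OF Q0 cop] by simp
  define g where "g x = a * x ^ 2 + b * x + t / ((x + r) * (x + r'))" for x
  \<comment> \<open>Both poles lie outside \<open>F\<close>, so f is finite on \<open>F\<close> and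
    bijectivity yields injectivity of g there.\<close>
  have Qx: "(x + r) * (x + r') \<noteq> 0" if "x \<in> F" for x
    using that \<open>r \<notin> F\<close> \<open>r' \<notin> F\<close> by (auto simp: add_eq_0_iff_eq)
  have map_Some: "rat_map f (Some x) = Some (g x)" if "x \<in> F" for x
  proof -
    have "poly Q x = (x + r) * (x + r')" by (simp add: Q_def algebra_simps)
    moreover have "poly P x = (a * x ^ 2 + b * x) * poly Q x + t"
      by (simp add: P_def power2_eq_square algebra_simps)
    ultimately show ?thesis using Qx[OF that] by (simp add: map g_def add_divide_distrib)
  qed
  have inj_g: "inj_on g F"
  proof (rule inj_onI)
    fix x y assume xy: "x \<in> F" "y \<in> F" "g x = g y"
    have "inj_on (rat_map f) (proj_line F)"
      using perm by (auto simp: perm_rat_fun_def bij_betw_def)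
    from inj_onD[OF this, of "Some x" "Some y"] show "x = y"
      using xy map_Some by (auto simp: proj_line_def)
  qed
  \<comment> \<open>Replacing x by t x and multiplying g by t makes the denominator x^2 + x + d. As
    b is 0 or 1, B is 0 or t^2.\<close>
  define A B d where "A = a * t ^ 3" and "B = b * t ^ 2" and "d = r * r' / t ^ 2"
  have quad: "(t * x + r) * (t * x + r') = t ^ 2 * (x ^ 2 + x + d)" for x
  proof -
    have "t ^ 2 * (x ^ 2 + x + d) = t ^ 2 * x ^ 2 + t * t * x + r * r'"
      using t by (simp add: d_def distrib_left power2_eq_square)
    also have "t * t * x = t * (r + r') * x" by (simp add: t_def)
    finally show ?thesis by (simp add: power2_eq_square algebra_simps)
  qed
  have no_root: "x ^ 2 + x + d \<noteq> 0" if "x \<in> F" for x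
    using quad[of x] Qx[of "t * x"] tF that by auto
  have scale: "A * x ^ 2 + B * x + inverse (x ^ 2 + x + d) = t * g (t * x)" for x
  proof -
    have frac: "t * (t / (t ^ 2 * z)) = inverse z" for z
      using t by (cases "z = 0") (simp_all add: field_simps power2_eq_square)
    have "t * g (t * x) =
        t * (a * (t * x) ^ 2) + t * (b * (t * x)) + t * (t / (t ^ 2 * (x ^ 2 + x + d)))"
      unfolding g_def quad by (simp only: distrib_left)
    thus ?thesis
      unfolding frac by (simp add: A_def B_def power2_eq_square power3_eq_cube ac_simps)
  qed
  have "inj_on (\<lambda>x. A * x ^ 2 + B * x + inverse (x ^ 2 + x + d)) F"
  proof (rule inj_onI)
    fix x y assume xy: "x \<in> F" "y \<in> F"
      "A * x ^ 2 + B * x + inverse (x ^ 2 + x + d) = A * y ^ 2 + B * y + inverse (y ^ 2 + y + d)"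
    hence "g (t * x) = g (t * y)" using t by (simp only: scale) simp
    hence "t * x = t * y" using inj_onD[OF inj_g] xy tF by blast
    thus "x = y" using t by simp
  qed
  moreover have "A \<in> F" "d \<in> F" "A \<noteq> 0" "B = 0 \<or> B = t ^ 2 \<and> t \<noteq> 0"
    using assms tF nF t by (auto simp: A_def B_def d_def)
  ultimately show False
    using not_inj_on_quartic[OF assms(1), of A t d B] tF no_root by blast
qed

end
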